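(* Let $p \in \mathbb{R}_{\geq 0}[x_1,\ldots,x_n]$ be a real stable polynomial in $n$ variables, and fix any $\kappa \in \mathbb{Z}^n$ with non-negative entries. If $p(\mathbf{1}) = 1$ and $\|\kappa - \nabla p(\mathbf{1})\|_1 < 1$, then $$p_{\kappa} \geq \left(\prod_{i=1}^n \frac{\kappa_i^{\kappa_i} e^{-\kappa_i}}{\kappa_i!}\right) \left(1 - \|\kappa - \nabla p(\mathbf{1})\|_1\right)^n,$$ where $p_{\kappa}$ is the coefficient of $x^{\kappa} = x_1^{\kappa_1}\cdots x_n^{\kappa_n}$ in $p$. The dependence on $\left(1 - \|\kappa - \nabla p(\mathbf{1})\|_1\right)$ is tight for any fixed $\kappa$ with strictly positive entries.
   Context: $\mathbb{R}_{\ge 0}[x_1,\dots,x_n]$ denotes the set of polynomials in $x_1,\dots,x_n$ with non-negative real coefficients (not necessarily homogeneous). A polynomial $p \in \mathbb{R}[z_1,\dots,z_n]$ is real stable if $p(z) \neq 0$ whenever $\operatorname{Im}(z_i) > 0$ for all $i \in \{1,\dots,n\}$. $\mathbf{1}$ is the all-ones vector, $\nabla p(\mathbf 1)$ is the gradient of $p$ at $\mathbf 1$, $\|\cdot\|_1$ is the $\ell^1$ norm, and $0^0$ is read as $1$. *)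

theory Defs
  imports "HOL-Analysis.Analysis" "HOL-Library.Poly_Mapping"
begin

text \<open>
  Polynomials in variables indexed by a finite type \<open>'n\<close>, so that the number of variables
  is \<open>CARD('n)\<close>. An exponent vector is a \<open>'n \<Rightarrow>\<^sub>0 nat\<close>, and \<open>Poly_Mapping.lookup p m\<close> is the
  coefficient in \<open>p\<close> of the monomial with exponent vector \<open>m\<close>.
\<close>

type_synonym 'n rpoly = "('n \<Rightarrow>\<^sub>0 nat) \<Rightarrow>\<^sub>0 real"

text \<open>The value type is left general: real points are needed for the normalisation and the
  gradient, complex points for stability.\<close>

definition mpoly_eval ::
    "('n::finite) rpoly \<Rightarrow> ('n \<Rightarrow> 'a) \<Rightarrow> 'a::{real_algebra_1, comm_ring_1}" where
  "mpoly_eval p x =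
     (\<Sum>m\<in>Poly_Mapping.keys p. of_real (Poly_Mapping.lookup p m) * (\<Prod>i\<in>UNIV. x i ^ Poly_Mapping.lookup m i))"

definition nonneg_coeffs :: "('n::finite) rpoly \<Rightarrow> bool" where
  "nonneg_coeffs p \<longleftrightarrow> (\<forall>m. 0 \<le> Poly_Mapping.lookup p m)"

definition real_stable :: "('n::finite) rpoly \<Rightarrow> bool" where
  "real_stable p \<longleftrightarrow>
     (\<forall>z :: 'n \<Rightarrow> complex. (\<forall>i. 0 < Im (z i)) \<longrightarrow> mpoly_eval p z \<noteq> 0)"

definition mpoly_gradient :: "('n::finite) rpoly \<Rightarrow> ('n \<Rightarrow> real) \<Rightarrow> 'n \<Rightarrow> real" where
  "mpoly_gradient p x i = deriv (\<lambda>t. mpoly_eval p (x(i := t))) (x i)"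

definition l1_norm :: "('n::finite \<Rightarrow> real) \<Rightarrow> real" where
  "l1_norm v = (\<Sum>i\<in>UNIV. \<bar>v i\<bar>)"

definition grad_dist :: "('n::finite \<Rightarrow>\<^sub>0 nat) \<Rightarrow> 'n rpoly \<Rightarrow> real" where
  "grad_dist \<kappa> p = l1_norm (\<lambda>i. real (Poly_Mapping.lookup \<kappa> i) - mpoly_gradient p (\<lambda>_. 1) i)"

end

theory Submission
  imports Defs "HOL-Complex_Analysis.Complex_Analysis" "HOL-Computational_Algebra.Fundamental_Theorem_Algebra"
begin

text \<open>
  The proof goes through the capacity bound \<open>p y \<ge> (1 - \<delta>) ^ n * y\<^sup>\<kappa>\<close> for all positive \<open>y\<close>, where
  \<open>\<delta>\<close> is the \<open>\<ell>\<^sub>1\<close> distance between \<open>\<kappa>\<close> and the gradient. Read the coefficients of \<open>p\<close> as weights of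
  exponent vectors, so that the gradient at the point of all ones is the mean exponent. Walk from that point to
  \<open>y\<close> in at most \<open>n\<close> stages, each of which multiplies the variables of a set \<open>S\<close> by a common factor:
  first \<open>S = {i. 1 < y i}\<close> by the least value of \<open>y\<close> on \<open>S\<close>, and so on, then likewise below 1. Along
  one stage \<open>p\<close> is a real-rooted univariate polynomial whose mean degree misses \<open>\<kappa>(S)\<close> by at most
  \<open>\<delta>\<close> in the harmful direction, and this costs only one factor \<open>1 - \<delta>\<close>. The bounds on the means survive
  for the later stages because scaling \<open>S\<close> up increases the mean exponent of every subset of \<open>S\<close> and
  decreases that of every set disjoint from \<open>S\<close>: the quotient of the two univariate polynomials
  that expresses such a mean maps the upper half plane to the lower one, hence has a partial fraction expansion with
  nonnegative residues at nonpositive poles.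

  Gurvits' argument turns capacity into a coefficient bound one variable at a time: for a real-rooted
  polynomial with nonnegative coefficients \<open>a\<^sub>j\<close> the sequence \<open>j! * a\<^sub>j\<close> is log-concave, so the polynomial is
  dominated by a multiple of an exponential function.
\<close>

subsection \<open>Limits of zero-free functions and stable sums of monomials\<close>

text \<open>By Hurwitz's theorem the limit of zero-free functions is zero-free or identically zero,
  and \<open>a\<close> excludes the latter. It may be real, since in every application nonvanishing
  is known from positivity at a real point.\<close>

lemma hurwitz_half_plane:
  fixes \<Psi> :: "real \<Rightarrow> complex \<Rightarrow> complex"
  assumes cont: "continuous_on UNIV (\<lambda>(s, w). \<Psi> s w)"
    and holo: "\<And>s. \<Psi> s holomorphic_on UNIV"
    and nz: "\<And>s w. 0 < s \<Longrightarrow> 0 < Im w \<Longrightarrow> \<Psi> s w \<noteq> 0"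
    and a: "0 \<le> Im a" "\<Psi> 0 a \<noteq> 0"
    and w: "0 < Im w"
  shows "\<Psi> 0 w \<noteq> 0"
proof -
  let ?S = "{z. 0 < Im z}"
  have conta: "continuous_on UNIV (\<Psi> 0)"
    using holo holomorphic_on_imp_continuous_on by blast
  \<comment> \<open>Continuity moves the nonzero value from \<open>a\<close> to a point
    \<open>b\<close> of the open half plane.\<close>
  have "(\<lambda>n. \<Psi> 0 (a + \<i> * of_real (1 / Suc n))) \<longlonglongrightarrow> \<Psi> 0 (a + \<i> * of_real 0)"
    by (rule continuous_on_tendsto_compose[OF conta])
       (intro tendsto_intros tendsto_of_real LIMSEQ_Suc[OF lim_1_over_n], simp_all)
  then have "eventually (\<lambda>n. \<Psi> 0 (a + \<i> * of_real (1 / Suc n)) \<noteq> 0) sequentially"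
    using a by (intro tendsto_imp_eventually_ne) auto
  then obtain n where n: "\<Psi> 0 (a + \<i> * of_real (1 / Suc n)) \<noteq> 0"
    by (meson eventually_happens sequentially_bot)
  define b where "b = a + \<i> * of_real (1 / Suc n)"
  have b: "b \<in> ?S" "\<Psi> 0 b \<noteq> 0" using n a by (auto simp: b_def add_nonneg_pos)
  show ?thesis
  \<comment> \<open>Hurwitz's theorem wants a nonconstant limit; a constant one takes the nonzero
    value found at \<open>b\<close>.\<close>
  proof (cases "\<Psi> 0 constant_on ?S")
    case True
    then show ?thesis using b w by (auto simp: constant_on_def)
  next
    case False
    show ?thesis
    proof (rule Hurwitz_no_zeros[where S = ?S and \<F> = "\<lambda>n. \<Psi> (1 / Suc n)" and g = "\<Psi> 0"])
      show "open ?S" by (rule open_halfspace_Im_gt)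
      show "connected ?S" by auto
      show "\<Psi> (1 / Suc n) holomorphic_on ?S" for n using holo holomorphic_on_subset by blast
      show "\<Psi> 0 holomorphic_on ?S" using holo holomorphic_on_subset by blast
      show "\<not> \<Psi> 0 constant_on ?S" by fact
      show "\<Psi> (1 / Suc n) z \<noteq> 0" if "z \<in> ?S" for n z using that nz by auto
      show "w \<in> ?S" using w by simp
      show "uniform_limit K (\<lambda>n. \<Psi> (1 / Suc n)) (\<Psi> 0) sequentially" if K: "compact K" for K
      proof (rule uniform_limitI)
        fix e :: real assume e: "0 < e"
        have "uniformly_continuous_on ({0..1} \<times> K) (\<lambda>(s, w). \<Psi> s w)"
          by (rule compact_uniformly_continuous)
             (use K cont in \<open>auto intro: continuous_on_subset compact_Times\<close>)
        then obtain d where d: "d > 0" "\<And>x x'. x \<in> {0..1} \<times> K \<Longrightarrow> x' \<in> {0..1} \<times> K \<Longrightarrow>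
            dist x' x < d \<Longrightarrow> dist ((\<lambda>(s, w). \<Psi> s w) x') ((\<lambda>(s, w). \<Psi> s w) x) < e"
          using e unfolding uniformly_continuous_on_def by metis
        have "eventually (\<lambda>n. \<bar>1 / real (Suc n)\<bar> < d) sequentially"
          using d(1) LIMSEQ_Suc[OF lim_1_over_n[where 'a = real]]
          by (auto dest: tendstoD simp: dist_norm)
        then show "\<forall>\<^sub>F n in sequentially. \<forall>x\<in>K. dist (\<Psi> (1 / Suc n) x) (\<Psi> 0 x) < e"
        proof eventually_elim
          case (elim n)
          then show ?case
            using d(2)[of "(0, x)" "(1 / Suc n, x)" for x] by (auto simp: dist_Pair_Pair dist_norm)
        qed
      qed
    qed
  qed
qed

text \<open>Filtering the index set, rescaling the weights and changing the exponents are all needed below, so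
  polynomials are handled as indexed families of weighted monomials rather than as \<open>'n rpoly\<close>.\<close>

definition wsum :: "'a set \<Rightarrow> ('a \<Rightarrow> 'n::finite \<Rightarrow> nat) \<Rightarrow> ('a \<Rightarrow> real) \<Rightarrow> ('n \<Rightarrow> 'b) \<Rightarrow> 'b::{real_algebra_1,comm_ring_1}"
  where "wsum A e c z = (\<Sum>a\<in>A. of_real (c a) * (\<Prod>i\<in>UNIV. z i ^ e a i))"

text \<open>Nonnegative weights are bundled in, because stability is combined with positivity at
  positive real points throughout. Different indices may share an exponent vector, as happens after
  differentiation.\<close>

definition stable_wsum :: "'a set \<Rightarrow> ('a \<Rightarrow> 'n::finite \<Rightarrow> nat) \<Rightarrow> ('a \<Rightarrow> real) \<Rightarrow> bool"
  where "stable_wsum A e c \<longleftrightarrow> finite A \<and> (\<forall>a\<in>A. 0 \<le> c a) \<and>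
    (\<forall>z :: 'n \<Rightarrow> complex. (\<forall>i. 0 < Im (z i)) \<longrightarrow> wsum A e c z \<noteq> 0)"

lemma wsum_of_real: "wsum A e c (\<lambda>i. of_real (x i)) = of_real (wsum A e c x)"
  by (simp add: wsum_def)

lemma wsum_pos:
  fixes x :: "'n::finite \<Rightarrow> real"
  assumes "finite A" "\<forall>a\<in>A. 0 \<le> c a" "\<exists>a\<in>A. 0 < c a" "\<And>i. 0 < x i"
  shows "0 < wsum A e c x"
proof -
  obtain a where a: "a \<in> A" "0 < c a" using assms by blast
  show ?thesis unfolding wsum_def
    by (rule sum_pos2[of _ a]) (use assms a in \<open>auto intro!: mult_pos_pos prod_pos mult_nonneg_nonneg prod_nonneg simp: less_imp_le\<close>)
qed

lemma stable_wsum_finite: "stable_wsum A e c \<Longrightarrow> finite A"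
  and stable_wsum_nonneg: "stable_wsum A e c \<Longrightarrow> a \<in> A \<Longrightarrow> 0 \<le> c a"
  and stable_wsum_nz: "stable_wsum A e c \<Longrightarrow> (\<And>i. 0 < Im (z i)) \<Longrightarrow> wsum A e c z \<noteq> 0"
  by (auto simp: stable_wsum_def)

lemma stable_wsum_ex_pos:
  assumes "stable_wsum A e c"
  shows "\<exists>a\<in>A. 0 < c a"
proof (rule ccontr)
  assume "\<not> ?thesis"
  then have "wsum A e c (\<lambda>_. \<i>) = 0"
    using stable_wsum_nonneg[OF assms] by (force simp: wsum_def intro!: sum.neutral)
  then show False using stable_wsum_nz[OF assms, of "\<lambda>_. \<i>"] by simp
qed

lemma stable_wsum_pos:
  "stable_wsum A e c \<Longrightarrow> (\<And>i. 0 < x i) \<Longrightarrow> 0 < wsum A e c (x :: _ \<Rightarrow> real)"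
  by (intro wsum_pos stable_wsum_ex_pos) (auto simp: stable_wsum_def)

lemma wsum_slice_holomorphic: "(\<lambda>w. wsum A e c (\<lambda>i. of_real (x i) + w * of_real (y i) + k i)) holomorphic_on S"
  unfolding wsum_def by (intro holomorphic_intros)

text \<open>Far along \<open>y\<close> every coordinate is positive; this provides the real point
  \<open>a\<close> for \<open>hurwitz_half_plane\<close>.\<close>

lemma ex_pos_point:
  fixes x y :: "'n::finite \<Rightarrow> real"
  assumes "\<And>i. 0 < y i \<or> (y i = 0 \<and> 0 < x i)"
  obtains t where "\<And>i. 0 < x i + t * y i"
proof -
  have "eventually (\<lambda>t. 0 < x i + t * y i) at_top" for i
  proof (cases "y i = 0")
    case False
    then have "0 < y i" using assms by auto
    then show ?thesis by real_asymp
  qed (use assms[of i] in auto)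
  then have "eventually (\<lambda>t. \<forall>i. 0 < x i + t * y i) at_top"
    by (simp add: eventually_all_finite)
  then show thesis using that eventually_happens'[OF trivial_limit_at_top_linorder] by blast
qed

text \<open>Coordinates on the positive real axis are pushed into the half plane by
  \<open>\<i> * s\<close>, and \<open>s\<close> tends to 0. To get a function of one variable,
  \<open>z\<close> is placed at \<open>w = \<i>\<close> on the complex line
  \<open>x + w * y\<close>, which meets the positive orthant at a real \<open>w\<close>.\<close>

lemma stable_wsum_boundary:
  fixes z :: "'n::finite \<Rightarrow> complex"
  assumes st: "stable_wsum A e c" and z: "\<And>i. 0 < Im (z i) \<or> (Im (z i) = 0 \<and> 0 < Re (z i))"
  shows "wsum A e c z \<noteq> 0"
proof -
  define x y where "x = (\<lambda>i. Re (z i))" and "y = (\<lambda>i. Im (z i))"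
  define \<Psi> where "\<Psi> = (\<lambda>(s::real) w. wsum A e c (\<lambda>i. of_real (x i) + w * of_real (y i) + \<i> * of_real s))"
  have y: "0 \<le> y i" for i using z[of i] by (auto simp: y_def)
  obtain t where t: "\<And>i. 0 < x i + t * y i"
    using ex_pos_point[of y x] z unfolding x_def y_def by blast
  have "\<Psi> 0 \<i> \<noteq> 0"
  proof (rule hurwitz_half_plane[where \<Psi> = \<Psi> and a = "of_real t"])
    show "continuous_on UNIV (\<lambda>(s, w). \<Psi> s w)"
      unfolding \<Psi>_def wsum_def case_prod_beta by (intro continuous_intros)
    show "\<Psi> s holomorphic_on UNIV" for s
      unfolding \<Psi>_def by (rule wsum_slice_holomorphic)
    show "\<Psi> s w \<noteq> 0" if "0 < s" "0 < Im w" for s w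
      unfolding \<Psi>_def using that z
      by (intro stable_wsum_nz[OF st]) (auto intro!: add_nonneg_pos mult_nonneg_nonneg y)
    have "\<Psi> 0 (of_real t) = of_real (wsum A e c (\<lambda>i. x i + t * y i))"
      unfolding \<Psi>_def by (subst wsum_of_real[symmetric]) simp
    then show "\<Psi> 0 (of_real t) \<noteq> 0"
      using stable_wsum_pos[OF st, of "\<lambda>i. x i + t * y i"] t by simp
  qed auto
  moreover have "\<Psi> 0 \<i> = wsum A e c z"
    unfolding \<Psi>_def x_def y_def by (simp add: complex_eq[symmetric])
  ultimately show ?thesis by simp
qed

text \<open>The quotient is the sum of \<open>1 / (w - a)\<close> over the roots \<open>a\<close>,
  all of which lie in the closed lower half plane.\<close>

lemma Im_pderiv_quotient:
  fixes f :: "complex poly"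
  assumes "\<And>z. 0 < Im z \<Longrightarrow> poly f z \<noteq> 0" "0 \<le> Im w" "poly f w \<noteq> 0"
  shows "Im (poly (pderiv f) w / poly f w) \<le> 0"
  using assms
proof (induction "Polynomial.degree f" arbitrary: f)
  case 0
  then have "pderiv f = 0" by (simp add: pderiv_eq_0_iff)
  then show ?case by simp
next
  case (Suc n)
  then obtain a where a: "poly f a = 0"
    using Fundamental_Theorem_Algebra.fundamental_theorem_of_algebra[of f] by (auto simp: constant_degree)
  then obtain g where g: "f = [:-a, 1:] * g" by (meson dvdE poly_eq_0_iff_dvd)
  have "g \<noteq> 0" using Suc.prems by (auto simp: g)
  then have "Polynomial.degree f = Suc (Polynomial.degree g)" unfolding g by (subst degree_mult_eq) auto
  then have IH: "Im (poly (pderiv g) w / poly g w) \<le> 0"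
    using Suc.hyps(2) Suc.prems by (intro Suc.hyps(1)) (auto simp: g)
  have "Im a \<le> 0" using a Suc.prems(1) by (meson not_le)
  then have 1: "Im (1 / (w - a)) \<le> 0"
    using Suc.prems(2) by (simp add: Im_divide divide_nonpos_nonneg)
  have nz: "w - a \<noteq> 0" "poly g w \<noteq> 0" using Suc.prems(3) by (auto simp: g)
  have "pderiv f = g + [:-a, 1:] * pderiv g"
    unfolding g by (subst pderiv_mult) (simp add: pderiv_pCons)
  then have "poly (pderiv f) w = poly g w + (w - a) * poly (pderiv g) w" by (simp add: left_diff_distrib)
  moreover have "poly f w = (w - a) * poly g w" by (simp add: g left_diff_distrib)
  ultimately have "poly (pderiv f) w / poly f w = 1 / (w - a) + poly (pderiv g) w / poly g w"
    using nz by (simp add: add_divide_distrib)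
  then show ?case using 1 IH by simp
qed

subsection \<open>Real-rooted univariate polynomials\<close>

abbreviation cpoly :: "real poly \<Rightarrow> complex poly"
  where "cpoly \<equiv> map_poly complex_of_real"

lemma poly_cpoly_of_real [simp]: "poly (cpoly p) (of_real x) = of_real (poly p x)"
  by (induction p) (simp_all add: map_poly_pCons)

lemma cpoly_mult: "cpoly (p * q) = cpoly p * cpoly q"
  by (rule poly_eqI) (simp add: coeff_map_poly coeff_mult)

text \<open>A nonreal root or its conjugate would lie in the upper half plane.\<close>

lemma stable_poly_has_root:
  assumes "0 < Polynomial.degree f" "\<And>z. 0 < Im z \<Longrightarrow> poly (cpoly f) z \<noteq> 0"
  obtains a where "poly f a = 0"
proof -
  have "Polynomial.degree (cpoly f) = Polynomial.degree f" by (intro degree_map_poly) auto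
  then obtain z where z: "poly (cpoly f) z = 0"
    using Fundamental_Theorem_Algebra.fundamental_theorem_of_algebra[of "cpoly f"] assms(1)
    by (auto simp: constant_degree)
  have "poly (cpoly f) (cnj z) = 0"
    using z by (subst real_poly_cnj_root_iff) (auto simp: coeff_map_poly)
  then have "Im z = 0" using assms(2)[of z] assms(2)[of "cnj z"] z by force
  then have "z = of_real (Re z)" by (simp add: complex_eq_iff)
  then have "poly f (Re z) = 0" using z by (metis of_real_eq_0_iff poly_cpoly_of_real)
  then show thesis using that by blast
qed

text \<open>\<open>M\<close> lists the negated roots with multiplicity, so that real-rootedness can
  be exploited by induction over \<open>M\<close>.\<close>

lemma stable_poly_factorization:
  assumes "f \<noteq> 0" "\<And>z. 0 < Im z \<Longrightarrow> poly (cpoly f) z \<noteq> 0" "\<And>r. 0 < r \<Longrightarrow> poly f r \<noteq> 0"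
  obtains M where "f = smult (lead_coeff f) (\<Prod>\<rho>\<in>#M. [:\<rho>, 1:])" "\<And>\<rho>. \<rho> \<in># M \<Longrightarrow> 0 \<le> \<rho>"
proof -
  have "\<exists>M. f = smult (lead_coeff f) (\<Prod>\<rho>\<in>#M. [:\<rho>, 1:]) \<and> (\<forall>\<rho>\<in>#M. 0 \<le> \<rho>)"
    using assms
  proof (induction "Polynomial.degree f" arbitrary: f)
    case 0
    then show ?case by (intro exI[of _ "{#}"]) (auto elim!: degree_eq_zeroE)
  next
    case (Suc n)
    obtain a where a: "poly f a = 0"
      using stable_poly_has_root[of f] Suc by (metis zero_less_Suc)
    then obtain g where g: "f = [:-a, 1:] * g" by (meson dvdE poly_eq_0_iff_dvd)
    have "g \<noteq> 0" using Suc.prems by (auto simp: g)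
    then have deg: "Polynomial.degree f = Suc (Polynomial.degree g)" unfolding g by (subst degree_mult_eq) auto
    have lc: "lead_coeff f = lead_coeff g" unfolding g by (subst lead_coeff_mult) simp
    obtain M where M: "g = smult (lead_coeff g) (\<Prod>\<rho>\<in>#M. [:\<rho>, 1:])" "\<forall>\<rho>\<in>#M. 0 \<le> \<rho>"
      using Suc.hyps(1)[of g] Suc.hyps(2) Suc.prems deg \<open>g \<noteq> 0\<close> unfolding g cpoly_mult by auto
    have "a \<le> 0" using Suc.prems(3) a by (meson not_le)
    then show ?case
      by (intro exI[of _ "add_mset (-a) M"])
         (use M lc g in \<open>auto simp del: mult_pCons_left simp flip: mult_smult_right\<close>)
  qed
  then show thesis using that by blast
qed

text \<open>If \<open>poly f 1 = 1\<close>, the left-hand side is, as a function of the mean degree \<open>poly (pderiv f) 1\<close>, the line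
  through \<open>(k, t ^ k)\<close> and \<open>(k + 1, t ^ (k + 1))\<close>. Equality holds for \<open>t ^ k * (1 - \<theta> + \<theta> * t)\<close>.\<close>

lemma prod_linear_lower_bound:
  fixes f :: "real poly"
  assumes f: "f = smult c (\<Prod>\<rho>\<in>#M. [:\<rho>, 1:])" and c: "0 < c" and M: "\<And>\<rho>. \<rho> \<in># M \<Longrightarrow> 0 \<le> \<rho>"
    and t: "0 < t"
  shows "t ^ k * (poly f 1 + (poly (pderiv f) 1 - real k * poly f 1) * (t - 1)) \<le> poly f t"
proof -
  \<comment> \<open>The induction needs arbitrary \<open>k\<close>, because a new factor may force a
    passage from \<open>k\<close> to \<open>k - 1\<close>; the signs ensure that \<open>k\<close> is
    then positive.\<close>
  have "(\<forall>k. t ^ k * (poly f 1 + (poly (pderiv f) 1 - real k * poly f 1) * (t - 1)) \<le> poly f t)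
     \<and> 0 \<le> poly (pderiv f) 1 \<and> 0 < poly f 1"
    using f M
  proof (induction M arbitrary: f)
    case empty
    have "t ^ k * (1 - real k * (t - 1)) \<le> 1" for k
    proof (induction k)
      case (Suc k)
      have "t ^ Suc k * (1 - real (Suc k) * (t - 1)) = t ^ k * (1 - real k * (t - 1)) - real (Suc k) * (t ^ k * (t - 1)^2)"
        by (simp add: algebra_simps power2_eq_square)
      also have "\<dots> \<le> t ^ k * (1 - real k * (t - 1))" using t by simp
      finally show ?case using Suc by simp
    qed simp
    then have "c * (t ^ k * (1 - real k * (t - 1))) \<le> c * 1" for k using c by (intro mult_left_mono) auto
    then show ?case using c by (simp add: empty algebra_simps pderiv_smult)
  next
    case (add \<rho> M)
    define g where "g = smult c (\<Prod>\<rho>\<in>#M. [:\<rho>, 1:])"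
    have f: "f = [:\<rho>, 1:] * g" by (simp add: add.prems g_def del: mult_pCons_left)
    have IH: "t ^ k * (poly g 1 + (poly (pderiv g) 1 - real k * poly g 1) * (t - 1)) \<le> poly g t"
      and g1: "0 \<le> poly (pderiv g) 1" "0 < poly g 1" for k
      using add.IH[OF g_def] add.prems by auto
    have \<rho>: "0 \<le> \<rho>" using add.prems by auto
    define G H where "G = poly g 1" and "H = poly (pderiv g) 1"
    have f1: "poly f 1 = (\<rho> + 1) * G" by (simp add: f G_def algebra_simps)
    have "pderiv f = g + [:\<rho>, 1:] * pderiv g"
      unfolding f by (subst pderiv_mult) (simp add: pderiv_pCons)
    then have f1': "poly (pderiv f) 1 = G + (\<rho> + 1) * H" by (simp add: G_def H_def algebra_simps)
    have ft: "poly f t = (\<rho> + t) * poly g t" by (simp add: f algebra_simps)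
    have "t ^ k * ((\<rho> + 1) * G + (G + (\<rho> + 1) * H - real k * ((\<rho> + 1) * G)) * (t - 1)) \<le> (\<rho> + t) * poly g t" for k
    \<comment> \<open>The new factor raises the mean degree by at most 1. If the mean degree
      \<open>H / G\<close> of \<open>g\<close> is at least \<open>k\<close>, the line for the same
      \<open>k\<close> suffices; otherwise the line for \<open>k - 1\<close> does.\<close>
    proof (cases "real k * G \<le> H")
      case True
      have "(\<rho> + 1) * G + (G + (\<rho> + 1) * H - real k * ((\<rho> + 1) * G)) * (t - 1) =
         (\<rho> + t) * (G + (H - real k * G) * (t - 1)) - (H - real k * G) * (t - 1)^2"
        by (simp add: algebra_simps power2_eq_square)
      also have "\<dots> \<le> (\<rho> + t) * (G + (H - real k * G) * (t - 1))" using True by simp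
      finally have "t ^ k * ((\<rho> + 1) * G + (G + (\<rho> + 1) * H - real k * ((\<rho> + 1) * G)) * (t - 1))
         \<le> t ^ k * ((\<rho> + t) * (G + (H - real k * G) * (t - 1)))" using t by (intro mult_left_mono) auto
      also have "\<dots> = (\<rho> + t) * (t ^ k * (G + (H - real k * G) * (t - 1)))" by simp
      also have "\<dots> \<le> (\<rho> + t) * poly g t"
        using IH[of k] \<rho> t by (intro mult_left_mono) (auto simp: G_def H_def)
      finally show ?thesis .
    next
      case False
      then obtain l where k: "k = Suc l" using g1 by (cases k) (auto simp: H_def)
      \<comment> \<open>This is \<open>H - l * G\<close>, the slope of the line for
        \<open>l = k - 1\<close>.\<close>
      define \<theta> where "\<theta> = H - real k * G + G"
      have \<theta>: "\<theta> \<le> G" using False by (simp add: \<theta>_def)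
      have "(\<rho> + t) * (G + \<theta> * (t - 1)) - t * ((\<rho> + 1) * G + (G + (\<rho> + 1) * (\<theta> - G)) * (t - 1)) = (\<rho> * (G - \<theta>)) * (t - 1)^2"
        by (simp add: algebra_simps power2_eq_square)
      moreover have "0 \<le> (\<rho> * (G - \<theta>)) * (t - 1)^2" using \<rho> \<theta> by simp
      ultimately have "t ^ l * (t * ((\<rho> + 1) * G + (G + (\<rho> + 1) * (\<theta> - G)) * (t - 1))) \<le> t ^ l * ((\<rho> + t) * (G + \<theta> * (t - 1)))"
        using t by (intro mult_left_mono) auto
      also have "\<dots> = (\<rho> + t) * (t ^ l * (G + (H - real l * G) * (t - 1)))" by (simp add: \<theta>_def k algebra_simps)
      also have "\<dots> \<le> (\<rho> + t) * poly g t"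
        using IH[of l] \<rho> t by (intro mult_left_mono) (auto simp: G_def H_def)
      finally show ?thesis by (simp add: k \<theta>_def algebra_simps)
    qed
    then show ?case using \<rho> g1 by (auto simp: f1 f1' ft G_def H_def)
  qed
  then show ?thesis by blast
qed

text \<open>The inequality for all \<open>i \<le> j\<close>, rather than for \<open>j = Suc i\<close> only, also excludes internal zeros.\<close>

lemma fact_coeff_log_concave:
  fixes f :: "real poly"
  assumes "f = smult c (\<Prod>\<rho>\<in>#M. [:\<rho>, 1:])" and c: "0 < c" and "\<And>\<rho>. \<rho> \<in># M \<Longrightarrow> 0 \<le> \<rho>"
  defines "a \<equiv> \<lambda>j. fact j * poly.coeff f j"
  shows "0 \<le> a j" "i \<le> j \<Longrightarrow> a i * a (Suc j) \<le> a (Suc i) * a j"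
proof -
  have "(\<forall>j. 0 \<le> fact j * poly.coeff f j) \<and> (\<forall>i j. i \<le> j \<longrightarrow>
     (fact i * poly.coeff f i) * (fact (Suc j) * poly.coeff f (Suc j)) \<le> (fact (Suc i) * poly.coeff f (Suc i)) * (fact j * poly.coeff f j))"
    using assms(1,3)
  proof (induction M arbitrary: f)
    case empty
    then show ?case using c by (auto simp: coeff_pCons split: nat.splits)
  next
    case (add \<rho> M)
    define g where "g = smult c (\<Prod>\<rho>\<in>#M. [:\<rho>, 1:])"
    have f: "f = [:\<rho>, 1:] * g" by (simp add: add.prems g_def del: mult_pCons_left)
    define b where "b = (\<lambda>j. fact j * poly.coeff g j)"
    have b0: "0 \<le> b j" and lc: "i \<le> j \<Longrightarrow> b i * b (Suc j) \<le> b (Suc i) * b j" for i j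
      using add.IH[OF g_def] add.prems by (auto simp: b_def)
    have \<rho>: "0 \<le> \<rho>" using add.prems by auto
    \<comment> \<open>The truncated \<open>j - 1\<close> at \<open>j = 0\<close> is harmless, being
      multiplied by 0.\<close>
    have a: "fact j * poly.coeff f j = \<rho> * b j + real j * b (j - 1)" for j
      by (cases j) (simp_all add: f b_def coeff_pCons algebra_simps)
    have "(\<rho> * b i + real i * b (i - 1)) * (\<rho> * b (Suc j) + real (Suc j) * b j)
       \<le> (\<rho> * b (Suc i) + real (Suc i) * b i) * (\<rho> * b j + real j * b (j - 1))" if "i \<le> j" for i j
    proof (cases "i = j")
      case False
      with that obtain l where j: "j = Suc l" "i \<le> l" by (cases j) auto
      \<comment> \<open>Both sides are expanded in powers of \<open>\<rho>\<close> and compared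
        coefficientwise: \<open>A\<close>, \<open>F\<close> and \<open>E\<close> handle
        \<open>\<rho>^2\<close>, \<open>\<rho>\<close> and the constant term.\<close>
      have A: "b i * b (Suc j) \<le> b (Suc i) * b j" using lc that by simp
      have B: "b i * b j \<le> b (Suc i) * b l" using lc j by simp
      have C: "real i * (b (i - 1) * b (Suc j)) \<le> real i * (b i * b j)"
        using lc[of "i - 1" j] that by (cases i) (auto intro!: mult_left_mono)
      have D: "real i * (b (i - 1) * b j) \<le> real i * (b i * b l)"
        using lc[of "i - 1" l] j by (cases i) (auto intro!: mult_left_mono)
      have "real i * real (Suc j) * (b (i - 1) * b j) = real (Suc j) * (real i * (b (i - 1) * b j))" by simp
      also have "\<dots> \<le> real (Suc j) * (real i * (b i * b l))" by (rule mult_left_mono[OF D]) simp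
      also have "\<dots> = (real i * real j + real i) * (b i * b l)" by (simp add: algebra_simps)
      also have "\<dots> \<le> (real i * real j + real j) * (b i * b l)"
        using that b0 by (intro mult_right_mono) auto
      finally have E: "real i * real (Suc j) * (b (i - 1) * b j) \<le> real (Suc i) * real j * (b i * b l)"
        by (simp add: algebra_simps)
      have "real j * (b i * b j) \<le> real j * (b (Suc i) * b l)" using B by (intro mult_left_mono) auto
      then have F: "real (Suc j) * (b i * b j) + real i * (b (i - 1) * b (Suc j)) \<le> real j * (b (Suc i) * b l) + real (Suc i) * (b i * b j)"
        using C by (simp add: algebra_simps)
      have "\<rho>^2 * (b i * b (Suc j)) + \<rho> * (real (Suc j) * (b i * b j) + real i * (b (i - 1) * b (Suc j))) + real i * real (Suc j) * (b (i - 1) * b j)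
         \<le> \<rho>^2 * (b (Suc i) * b j) + \<rho> * (real j * (b (Suc i) * b l) + real (Suc i) * (b i * b j)) + real (Suc i) * real j * (b i * b l)"
        by (rule add_mono[OF add_mono[OF mult_left_mono[OF A] mult_left_mono[OF F]] E]) (use \<rho> in auto)
      then show ?thesis by (simp add: j algebra_simps power2_eq_square)
    qed simp
    then show ?case using \<rho> b0 by (simp only: a) (auto simp del: of_nat_Suc)
  qed
  then show "0 \<le> a j" "i \<le> j \<Longrightarrow> a i * a (Suc j) \<le> a (Suc i) * a j" by (auto simp: a_def)
qed

text \<open>Log-concavity gives some \<open>r\<close> with
  \<open>a j * r ^ k \<le> a k * r ^ j\<close> for all \<open>j\<close>. Hence
  \<open>poly f w * r ^ k \<le> a k * exp (r * w)\<close>, and a good choice of \<open>w\<close>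
  yields the bound.\<close>

lemma coeff_ge_capacity:
  fixes f :: "real poly"
  assumes f: "f = smult c (\<Prod>\<rho>\<in>#M. [:\<rho>, 1:])" "0 < c" "\<And>\<rho>. \<rho> \<in># M \<Longrightarrow> 0 \<le> \<rho>"
    and C: "0 \<le> C" and cap: "\<And>w. 0 < w \<Longrightarrow> C * w ^ k \<le> poly f w"
  shows "C * (real k ^ k * exp (- real k) / fact k) \<le> poly.coeff f k"
proof -
  define a where "a = (\<lambda>j. fact j * poly.coeff f j)"
  have a0: "0 \<le> a j" and lc: "i \<le> j \<Longrightarrow> a i * a (Suc j) \<le> a (Suc i) * a j" for i j
    using fact_coeff_log_concave[OF f] by (auto simp: a_def)
  have coeff: "poly.coeff f j = a j / fact j" for j by (simp add: a_def)
  have f0: "0 \<le> poly.coeff f j" for j using a0 by (simp add: coeff)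
  have pf: "poly f w = (\<Sum>j\<le>Polynomial.degree f. poly.coeff f j * w ^ j)" for w by (rule poly_altdef)
  have f1: "0 \<le> poly f 1" unfolding pf using f0 by (intro sum_nonneg) auto
  \<comment> \<open>For \<open>k = 0\<close> the bound is a limit at 0. In the last two cases the
    coefficient vanishes and \<open>C = 0\<close> is forced: all terms have degree below
    \<open>k\<close>, seen at infinity, or above \<open>k\<close>, seen near 0.\<close>
  consider "k = 0" | l where "k = Suc l" "0 < a k" | "0 < k" "a k = 0" "\<exists>i<k. 0 < a i" | "0 < k" "a k = 0" "\<forall>i<k. a i = 0"
    using a0 by (metis not0_implies_Suc order_le_less not_gr0)
  then show ?thesis
  proof cases
    case 1
    have "(poly f \<longlongrightarrow> poly f 0) (at_right 0)"
      by (rule tendsto_poly[OF tendsto_ident_at])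
    moreover have "eventually (\<lambda>w. C \<le> poly f w) (at_right 0)"
      using cap 1 by (auto simp: eventually_at_right_less eventually_at_filter)
    ultimately have "C \<le> poly f 0" by (intro tendsto_lowerbound[where F = "at_right 0"]) auto
    then show ?thesis by (simp add: 1 poly_0_coeff_0)
  next
    case (2 l)
    \<comment> \<open>The geometric sequence through \<open>a k\<close> with ratio \<open>r\<close>
      is to dominate \<open>a\<close> on both sides of \<open>k\<close>.\<close>
    have "\<exists>r>0. (\<forall>j\<ge>k. a (Suc j) \<le> r * a j) \<and> (\<forall>j<k. r * a j \<le> a (Suc j))"
    proof (cases "a l = 0")
      case False
      then have al: "0 < a l" using a0[of l] by simp
      show ?thesis
      proof (intro exI[of _ "a k / a l"] conjI allI impI)
        show "0 < a k / a l" using 2 al by simp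
        show "a (Suc j) \<le> a k / a l * a j" if "k \<le> j" for j
          using lc[of l j] that 2 al by (simp add: field_simps)
        show "a k / a l * a j \<le> a (Suc j)" if "j < k" for j
          using lc[of j l] that 2 al by (simp add: field_simps)
      qed
    next
      case True
      show ?thesis
      \<comment> \<open>As \<open>a l = 0\<close>, log-concavity kills all coefficients below
        \<open>k\<close>, so only the ratio to the right constrains \<open>r\<close>; adding 1 makes
        it positive.\<close>
      proof (intro exI[of _ "a (Suc k) / a k + 1"] conjI allI impI)
        show "0 < a (Suc k) / a k + 1" using 2 a0[of "Suc k"] by (simp add: add_nonneg_pos)
        show "a (Suc j) \<le> (a (Suc k) / a k + 1) * a j" if "k \<le> j" for j
        proof -
          have "a (Suc j) \<le> a (Suc k) / a k * a j" using lc[of k j] that 2 by (simp add: field_simps)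
          also have "\<dots> \<le> (a (Suc k) / a k + 1) * a j" using a0 by (intro mult_right_mono) auto
          finally show ?thesis .
        qed
        show "(a (Suc k) / a k + 1) * a j \<le> a (Suc j)" if "j < k" for j
        proof -
          have "a j * a k \<le> 0" using lc[of j l] that 2 True by simp
          then have "a j = 0" using a0[of j] 2 by (simp add: mult_le_0_iff)
          then show ?thesis using a0 by simp
        qed
      qed
    qed
    then obtain r where r: "0 < r" "\<And>j. k \<le> j \<Longrightarrow> a (Suc j) \<le> r * a j" "\<And>j. j < k \<Longrightarrow> r * a j \<le> a (Suc j)"
      by blast
    have up: "a (k + m) \<le> a k * r ^ m" for m
    proof (induction m)
      case (Suc m)
      have "a (k + Suc m) \<le> r * a (k + m)" using r(2)[of "k + m"] by simp
      also have "\<dots> \<le> r * (a k * r ^ m)" using Suc r by (intro mult_left_mono) auto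
      finally show ?case by (simp add: ac_simps)
    qed simp
    have down: "m \<le> k \<Longrightarrow> a (k - m) * r ^ m \<le> a k" for m
    proof (induction m)
      case (Suc m)
      have "a (k - Suc m) * r ^ Suc m = (r * a (k - Suc m)) * r ^ m" by simp
      also have "\<dots> \<le> a (Suc (k - Suc m)) * r ^ m" using r Suc.prems by (intro mult_right_mono) auto
      also have "\<dots> \<le> a k" using Suc by (simp add: Suc_diff_Suc)
      finally show ?case .
    qed simp
    have bound: "a j * r ^ k \<le> a k * r ^ j" for j
    proof (cases "k \<le> j")
      case True
      then have "a j * r ^ k \<le> (a k * r ^ (j - k)) * r ^ k" using up[of "j - k"] r by (intro mult_right_mono) auto
      also have "\<dots> = a k * r ^ j" using True by (simp add: mult.assoc flip: power_add)
      finally show ?thesis .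
    next
      case False
      then have "(a j * r ^ (k - j)) * r ^ j \<le> a k * r ^ j" using down[of "k - j"] r by (intro mult_right_mono) auto
      moreover have "(a j * r ^ (k - j)) * r ^ j = a j * r ^ k" using False by (simp add: mult.assoc flip: power_add)
      ultimately show ?thesis by simp
    qed
    \<comment> \<open>This point minimises \<open>exp (r * w) / w ^ k\<close>.\<close>
    define w where "w = real k / r"
    have w: "0 < w" "r * w = real k" using r 2 by (auto simp: w_def)
    have "C * w ^ k * r ^ k \<le> poly f w * r ^ k" using cap[OF w(1)] r by (intro mult_right_mono) auto
    also have "\<dots> = (\<Sum>j\<le>Polynomial.degree f. (a j * r ^ k) * (w ^ j / fact j))"
      unfolding pf sum_distrib_right by (intro sum.cong) (auto simp: coeff)
    also have "\<dots> \<le> (\<Sum>j\<le>Polynomial.degree f. (a k * r ^ j) * (w ^ j / fact j))"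
      using bound w by (intro sum_mono mult_right_mono) auto
    also have "\<dots> = a k * (\<Sum>j\<le>Polynomial.degree f. (r * w) ^ j / fact j)"
      unfolding sum_distrib_left by (intro sum.cong) (auto simp: power_mult_distrib)
    also have "\<dots> \<le> a k * exp (r * w)"
    proof (intro mult_left_mono a0)
      have "(\<Sum>j\<le>Polynomial.degree f. (r * w) ^ j /\<^sub>R fact j) \<le> suminf (\<lambda>j. (r * w) ^ j /\<^sub>R fact j)"
        using r w by (intro sum_le_suminf summable_exp_generic) auto
      then show "(\<Sum>j\<le>Polynomial.degree f. (r * w) ^ j / fact j) \<le> exp (r * w)"
        by (simp add: exp_def divide_inverse mult.commute)
    qed
    finally have "C * (r * w) ^ k \<le> a k * exp (r * w)" by (simp add: power_mult_distrib ac_simps)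
    then have "C * real k ^ k * exp (- real k) \<le> a k"
      unfolding w by (simp add: exp_minus field_simps)
    then show ?thesis unfolding coeff by (simp add: field_simps)
  next
    case 3
    \<comment> \<open>From the last positive entry below \<open>k\<close>, log-concavity propagates
      the zero at \<open>Suc i\<close> to all larger indices.\<close>
    define i where "i = Max {i. i < k \<and> 0 < a i}"
    have "i \<in> {i. i < k \<and> 0 < a i}" unfolding i_def using 3 by (intro Max_in) auto
    then have i: "i < k" "0 < a i" by auto
    have "a (Suc i) = 0"
    proof (rule ccontr)
      assume *: "a (Suc i) \<noteq> 0"
      then have "Suc i \<noteq> k" using 3 by auto
      with * i a0[of "Suc i"] have "Suc i \<in> {i. i < k \<and> 0 < a i}" by auto
      then have "Suc i \<le> i" unfolding i_def by (intro Max_ge) auto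
      then show False by simp
    qed
    then have "a i * a (Suc j) \<le> 0" if "i \<le> j" for j using lc[OF that] by simp
    then have aj: "a (Suc j) = 0" if "i \<le> j" for j
      using that i a0[of "Suc j"] by (intro antisym) (auto simp: mult_le_0_iff)
    have big: "poly.coeff f j = 0" if "k \<le> j" for j
      using that i aj[of "j - 1"] by (simp add: coeff)
    have "poly f w \<le> poly f 1 * w ^ (k - 1)" if "1 \<le> w" for w
      unfolding pf sum_distrib_right
    proof (intro sum_mono)
      fix j
      show "poly.coeff f j * w ^ j \<le> poly.coeff f j * 1 ^ j * w ^ (k - 1)"
        using that f0[of j] big[of j] by (cases "k \<le> j") (auto intro!: mult_left_mono power_increasing)
    qed
    then have "C * w ^ k \<le> poly f 1 * w ^ (k - 1)" if "1 \<le> w" for w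
      using cap[of w] that by (meson less_le_trans order.trans zero_less_one)
    moreover have "w ^ k = w * w ^ (k - 1)" for w :: real using 3 by (cases k) auto
    ultimately have *: "C * w \<le> poly f 1" if "1 \<le> w" for w
      using that by (metis (no_types, opaque_lifting) less_le_trans mult.assoc mult_le_cancel_right_pos zero_less_one zero_less_power)
    have "C = 0"
    proof (rule ccontr)
      assume "C \<noteq> 0"
      then have "0 < C" using C by simp
      with *[of "poly f 1 / C + 1"] f1 show False by (simp add: field_simps mult_le_0_iff)
    qed
    then show ?thesis using f0 by simp
  next
    case 4
    have small: "poly.coeff f j = 0" if "j \<le> k" for j
      using that 4 by (cases "j = k") (auto simp: coeff)
    have bd: "poly f w \<le> poly f 1 * w ^ Suc k" if "0 < w" "w \<le> 1" for w
      unfolding pf sum_distrib_right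
    proof (intro sum_mono)
      fix j
      show "poly.coeff f j * w ^ j \<le> poly.coeff f j * 1 ^ j * w ^ Suc k"
        using that f0[of j] small[of j]
        by (cases "j \<le> k") (auto intro!: mult_left_mono power_decreasing simp del: power_Suc)
    qed
    have *: "C \<le> poly f 1 * w" if w: "0 < w" "w \<le> 1" for w
    proof -
      have "C * w ^ k \<le> (poly f 1 * w) * w ^ k"
        using order.trans[OF cap[OF w(1)] bd[OF w]] by (simp add: mult.assoc)
      then show ?thesis using w by simp
    qed
    have "C = 0"
    proof (rule ccontr)
      assume "C \<noteq> 0"
      then have "0 < C" using C by simp
      then have D: "0 < C + poly f 1 + 1" "0 < C * (C + 1)" using f1 by auto
      have "C \<le> poly f 1 * (C / (C + poly f 1 + 1))"
        using \<open>0 < C\<close> f1 D by (intro *) (auto simp: divide_simps)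
      then have "C * (C + 1) \<le> 0" using D(1) by (simp add: field_simps)
      then show False using D(2) by simp
    qed
    then show ?thesis using f0 by simp
  qed
qed

subsection \<open>Quotients mapping the upper half plane to the lower one\<close>

text \<open>Near \<open>a\<close> the quotient behaves like \<open>v / (z - a) ^ m\<close>.
  Approached in direction \<open>\<phi>\<close>, its imaginary part has the sign of
  \<open>- v * sin (m * \<phi>)\<close>, which is nonpositive for all \<open>\<phi>\<close> between
  0 and \<open>pi\<close> only if \<open>m = 1\<close> and \<open>v > 0\<close>.\<close>

lemma residue_pos:
  fixes G H K :: "real poly"
  assumes H: "H = [:-a, 1:] ^ m * K" "0 < m" and nz: "poly K a \<noteq> 0" "poly G a \<noteq> 0"
    and Im: "\<And>z. 0 < Im z \<Longrightarrow> Im (poly (cpoly G) z / poly (cpoly H) z) \<le> 0"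
  shows "m = 1" "0 < poly G a / poly K a"
proof -
  define v where "v = poly G a / poly K a"
  have v: "v \<noteq> 0" using nz by (simp add: v_def)
  have cH: "poly (cpoly H) z = (z - of_real a) ^ m * poly (cpoly K) z" for z
  proof -
    have "poly (cpoly ([:-a, 1:] ^ m)) z = (z - of_real a) ^ m"
      by (induction m) (simp_all only: power_0 power_Suc cpoly_mult, simp_all add: map_poly_pCons left_diff_distrib)
    then show ?thesis by (simp add: H cpoly_mult)
  qed
  have key: "0 \<le> v * sin (real m * \<phi>)" if \<phi>: "0 < \<phi>" "\<phi> < pi" for \<phi>
  proof -
    define z where "z = (\<lambda>\<epsilon>::real. of_real a + of_real \<epsilon> * cis \<phi>)"
    define g where "g = (\<lambda>\<epsilon>. poly (cpoly G) (z \<epsilon>) / poly (cpoly K) (z \<epsilon>) * cis (- (real m * \<phi>)))"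
    have "((\<lambda>\<epsilon>. Im (g \<epsilon>)) \<longlongrightarrow> Im (poly (cpoly G) (of_real a + of_real 0 * cis \<phi>) / poly (cpoly K) (of_real a + of_real 0 * cis \<phi>) * cis (- (real m * \<phi>)))) (at_right 0)"
      unfolding g_def z_def using nz by (intro tendsto_intros) auto
    then have lim: "((\<lambda>\<epsilon>. Im (g \<epsilon>)) \<longlongrightarrow> - (v * sin (real m * \<phi>))) (at_right 0)"
      by (simp add: v_def flip: of_real_divide)
    have "Im (g \<epsilon>) \<le> 0" if "0 < \<epsilon>" for \<epsilon>
    proof -
      have "0 < Im (z \<epsilon>)" using \<phi> that by (simp add: z_def sin_gt_zero)
      then have le: "Im (poly (cpoly G) (z \<epsilon>) / poly (cpoly H) (z \<epsilon>)) \<le> 0" by (rule Im)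
      have "(z \<epsilon> - of_real a) ^ m = of_real (\<epsilon> ^ m) * cis (real m * \<phi>)"
        by (simp add: z_def power_mult_distrib Complex.DeMoivre)
      then have "poly (cpoly G) (z \<epsilon>) / poly (cpoly H) (z \<epsilon>) = g \<epsilon> / of_real (\<epsilon> ^ m)"
        by (simp add: cH g_def cis_divide[symmetric] divide_inverse flip: cis_inverse)
      then have "g \<epsilon> = of_real (\<epsilon> ^ m) * (poly (cpoly G) (z \<epsilon>) / poly (cpoly H) (z \<epsilon>))" using that by simp
      then have "Im (g \<epsilon>) = \<epsilon> ^ m * Im (poly (cpoly G) (z \<epsilon>) / poly (cpoly H) (z \<epsilon>))"
        by (metis scaleR_complex.sel(2) scaleR_conv_of_real)
      then show ?thesis using le that by (simp add: mult_nonneg_nonpos)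
    qed
    then have "eventually (\<lambda>\<epsilon>. Im (g \<epsilon>) \<le> 0) (at_right 0)" by (auto simp: eventually_at_filter)
    then have "- (v * sin (real m * \<phi>)) \<le> 0" using lim by (intro tendsto_upperbound[OF lim]) auto
    then show ?thesis by simp
  qed
  \<comment> \<open>This angle makes the sine 1 and so reveals the sign of \<open>v\<close>.\<close>
  have "0 \<le> v * sin (real m * (pi / (2 * real m)))" using H by (intro key) (auto simp: field_simps)
  moreover have "real m * (pi / (2 * real m)) = pi / 2" using H by simp
  ultimately have "0 \<le> v * sin (pi / 2)" by (simp only:)
  then have v0: "0 < v" using v by simp
  then show "0 < poly G a / poly K a" by (simp add: v_def)
  show "m = 1"
  proof (rule ccontr)
    assume "m \<noteq> 1"
    then have "2 \<le> m" using H by simp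
    \<comment> \<open>For \<open>m \<ge> 2\<close> this angle is still below \<open>pi\<close>, and
      it makes the sine -1.\<close>
    then have "0 \<le> v * sin (real m * (3 * pi / (2 * real m)))" by (intro key) (auto simp: field_simps)
    moreover have "real m * (3 * pi / (2 * real m)) = 3 / 2 * pi" using H by simp
    ultimately have "0 \<le> v * sin (3 / 2 * pi)" by (simp only:)
    then have "0 \<le> v * (- 1)" by (simp only: sin_3over2_pi)
    then show False using v0 by simp
  qed
qed

lemma mset_size_le_card: "(\<And>x. count M x \<le> 1) \<Longrightarrow> size M \<le> card (set_mset M)"
  unfolding size_multiset_overloaded_eq
  using sum_bounded_above[of "set_mset M" "count M" 1] by simp

text \<open>Common roots of \<open>G\<close> and \<open>H\<close> are cancelled by induction.
  Without them \<open>residue_pos\<close> makes all roots of \<open>H\<close> simple with positive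
  residues, and interpolation at these roots gives the expansion; \<open>c\<close> comes from the
  coefficients of degree \<open>degree H\<close>.\<close>

lemma stable_quotient_partial_fractions:
  fixes G H :: "real poly"
  assumes "0 < lead_coeff H" "Polynomial.degree G \<le> Polynomial.degree H" "0 \<le> poly.coeff G (Polynomial.degree H)"
    and "\<And>r. 0 < r \<Longrightarrow> poly H r \<noteq> 0"
    and "\<And>z. 0 < Im z \<Longrightarrow> poly (cpoly H) z \<noteq> 0"
    and "\<And>z. 0 < Im z \<Longrightarrow> Im (poly (cpoly G) z / poly (cpoly H) z) \<le> 0"
  shows "\<exists>R c w. finite R \<and> (\<forall>a\<in>R. a \<le> 0 \<and> 0 \<le> w a) \<and> 0 \<le> c \<and>
    (\<forall>r>0. poly G r / poly H r = c + (\<Sum>a\<in>R. w a / (r - a)))"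
  using assms
proof (induction "Polynomial.degree H" arbitrary: G H rule: less_induct)
  case less
  have H0: "H \<noteq> 0" using less.prems(1) by auto
  have neg: "a \<le> 0" if "poly H a = 0" for a using less.prems(4)[of a] that by (meson not_le)
  show ?case
  proof (cases "\<exists>a. poly H a = 0 \<and> poly G a = 0")
    case True
    then obtain a where a: "poly H a = 0" "poly G a = 0" by blast
    obtain H1 where H1: "H = [:-a, 1:] * H1" using a(1) by (meson dvdE poly_eq_0_iff_dvd)
    obtain G1 where G1: "G = [:-a, 1:] * G1" using a(2) by (meson dvdE poly_eq_0_iff_dvd)
    have "H1 \<noteq> 0" using H0 by (auto simp: H1)
    then have degH: "Polynomial.degree H = Suc (Polynomial.degree H1)" unfolding H1 by (subst degree_mult_eq) auto
    have degG: "G1 = 0 \<or> Polynomial.degree G = Suc (Polynomial.degree G1)"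
      by (cases "G1 = 0") (simp_all add: G1 degree_mult_eq del: mult_pCons_left)
    have cz: "poly (cpoly G) z / poly (cpoly H) z = poly (cpoly G1) z / poly (cpoly H1) z" if "0 < Im z" for z
    proof -
      have "z \<noteq> of_real a" using that by auto
      then show ?thesis by (simp add: G1 H1 cpoly_mult map_poly_pCons del: mult_pCons_left)
    qed
    have rz: "poly G r / poly H r = poly G1 r / poly H1 r" if "0 < r" for r
    proof -
      have "r \<noteq> a" using that neg a by fastforce
      then show ?thesis by (simp add: G1 H1 del: mult_pCons_left)
    qed
    have "\<exists>R c w. finite R \<and> (\<forall>a\<in>R. a \<le> 0 \<and> 0 \<le> w a) \<and> 0 \<le> c \<and>
      (\<forall>r>0. poly G1 r / poly H1 r = c + (\<Sum>a\<in>R. w a / (r - a)))"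
    proof (rule less.hyps)
      show "Polynomial.degree H1 < Polynomial.degree H" by (simp add: degH)
      show "0 < lead_coeff H1" using less.prems(1) unfolding H1 by (subst (asm) lead_coeff_mult) simp
      show le: "Polynomial.degree G1 \<le> Polynomial.degree H1" using degG degH less.prems(2) by auto
      have "poly.coeff G1 (Suc (Polynomial.degree H1)) = 0" using le by (intro coeff_eq_0) auto
      then show "0 \<le> poly.coeff G1 (Polynomial.degree H1)"
        using less.prems(3) unfolding degH by (simp add: G1)
      show "poly H1 r \<noteq> 0" if "0 < r" for r using less.prems(4)[OF that] by (auto simp: H1)
      show "poly (cpoly H1) z \<noteq> 0" if "0 < Im z" for z
        using less.prems(5)[OF that] by (auto simp: H1 cpoly_mult simp del: mult_pCons_left)
      show "Im (poly (cpoly G1) z / poly (cpoly H1) z) \<le> 0" if "0 < Im z" for z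
        using less.prems(6)[OF that] cz[OF that] by simp
    qed
    then show ?thesis using rz by metis
  next
    case False
    define n where "n = Polynomial.degree H"
    define A where "A = lead_coeff H"
    have A: "0 < A" using less.prems(1) by (simp add: A_def)
    define R where "R = {a. poly H a = 0}"
    have fin: "finite R" unfolding R_def using H0 by (rule poly_roots_finite)
    obtain M where M: "H = smult (lead_coeff H) (\<Prod>\<rho>\<in>#M. [:\<rho>, 1:])"
      using stable_poly_factorization[OF H0 less.prems(5,4)] by metis
    have ord: "order a H \<le> 1" for a
    proof (cases "order a H = 0")
      case False
      obtain q where q: "H = [:-a, 1:] ^ order a H * q" "\<not> [:-a, 1:] dvd q"
        using order_decomp[OF H0] by blast
      have "poly H a = 0" using False H0 order_root by blast
      with \<open>\<not> (\<exists>a. _ a)\<close> have "poly G a \<noteq> 0" by blast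
      then show ?thesis
        using residue_pos(1)[of H a "order a H" q G] q False less.prems(6) by (auto simp: poly_eq_0_iff_dvd)
    qed simp
    have cM: "count M \<rho> \<le> 1" for \<rho>
    proof (rule ccontr)
      assume *: "\<not> count M \<rho> \<le> 1"
      then have "replicate_mset 2 \<rho> \<subseteq># M" by (simp flip: count_le_replicate_mset_subset_eq)
      then obtain M' where "M = replicate_mset 2 \<rho> + M'" by (metis subset_mset.add_diff_inverse)
      then have "H = smult (lead_coeff H) ([:\<rho>, 1:] * ([:\<rho>, 1:] * (\<Prod>\<rho>\<in>#M'. [:\<rho>, 1:])))"
        by (subst M) (simp add: numeral_2_eq_2 del: mult_pCons_left)
      also have "\<dots> = [:\<rho>, 1:]^2 * smult (lead_coeff H) (\<Prod>\<rho>\<in>#M'. [:\<rho>, 1:])"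
        by (simp only: power2_eq_square mult.assoc mult_smult_right)
      finally have "[:- (- \<rho>), 1:]^2 dvd H" by (metis dvd_triv_left minus_minus)
      then have "2 \<le> order (- \<rho>) H" using H0 order_divides by blast
      then show False using ord[of "- \<rho>"] by simp
    qed
    \<comment> \<open>\<open>M\<close> lists the negated roots of \<open>H\<close>, now known to be
      simple, so \<open>R\<close> has at least \<open>n\<close> elements.\<close>
    have "n = size M"
    proof -
      have "Polynomial.degree (\<Prod>\<rho>\<in>#M. [:\<rho>, 1:]) = size M"
        by (induction M) (auto simp: degree_mult_eq prod_mset_zero_iff image_iff simp del: mult_pCons_left)
      then show ?thesis unfolding n_def using A M by (metis A_def degree_smult_eq less_irrefl)
    qed
    also have "\<dots> \<le> card (set_mset M)" using cM by (rule mset_size_le_card)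
    also have "\<dots> = card (uminus ` set_mset M)" by (simp add: card_image)
    also have "\<dots> \<le> card R"
    proof (intro card_mono fin)
      have "poly H (- \<rho>) = 0" if "\<rho> \<in># M" for \<rho>
        using that by (subst M) (simp add: poly_prod_mset)
      then show "uminus ` set_mset M \<subseteq> R" by (auto simp: R_def)
    qed
    finally have nR: "n \<le> card R" .
    have Kex: "\<exists>K. H = [:-a, 1:] * K" if "a \<in> R" for a
      using that unfolding R_def by (metis dvdE mem_Collect_eq poly_eq_0_iff_dvd)
    define K where "K = (\<lambda>a. SOME K. H = [:-a, 1:] * K)"
    have K: "H = [:-a, 1:] * K a" if "a \<in> R" for a
      unfolding K_def by (rule someI_ex[OF Kex[OF that]])
    have degK: "Polynomial.degree (K a) < n" if "a \<in> R" for a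
    proof -
      have "K a \<noteq> 0" using K[OF that] H0 by auto
      then have "Polynomial.degree ([:-a, 1:] * K a) = Suc (Polynomial.degree (K a))" by (subst degree_mult_eq) auto
      then show ?thesis using K[OF that] by (simp add: n_def del: mult_pCons_left)
    qed
    have Ka: "poly (K a) a \<noteq> 0" if "a \<in> R" for a
    proof
      assume "poly (K a) a = 0"
      then obtain L where "K a = [:-a, 1:] * L" by (meson dvdE poly_eq_0_iff_dvd)
      then have "[:-a, 1:]^2 dvd H" using K[OF that] by (metis dvd_triv_left mult.assoc power2_eq_square)
      then have "2 \<le> order a H" using H0 by (simp add: order_divides)
      then show False using ord[of a] by simp
    qed
    have Kb: "poly (K a) b = 0" if "a \<in> R" "b \<in> R" "a \<noteq> b" for a b
    proof -
      have "(b - a) * poly (K a) b = 0"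
        using arg_cong[OF K[OF that(1)], of "\<lambda>p. poly p b"] that(2) by (auto simp: R_def algebra_simps)
      then show ?thesis using that by simp
    qed
    define w where "w = (\<lambda>a. poly G a / poly (K a) a)"
    define c where "c = poly.coeff G n / A"
    have w: "0 \<le> w a" if "a \<in> R" for a
    proof -
      have "poly G a \<noteq> 0" using False that by (auto simp: R_def)
      then have "0 < poly G a / poly (K a) a"
        using residue_pos(2)[of H a 1 "K a" G] K[OF that] Ka[OF that] less.prems(6) by auto
      then show ?thesis by (simp add: w_def)
    qed
    \<comment> \<open>Both sides have degree at most \<open>n\<close>, the same coefficient at
      \<open>n\<close> and the same values on \<open>R\<close>.\<close>
    have G: "G = smult c H + (\<Sum>a\<in>R. smult (w a) (K a))"
    proof (rule poly_eqI_degree_lead_coeff[where n = n and A = R])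
      have "poly.coeff (K a) n = 0" if "a \<in> R" for a using degK[OF that] by (rule coeff_eq_0)
      then show "poly.coeff G n = poly.coeff (smult c H + (\<Sum>a\<in>R. smult (w a) (K a))) n"
        using A H0 by (simp add: coeff_sum c_def n_def A_def)
      show "n \<le> card R" by (rule nR)
      show "Polynomial.degree G \<le> n" using less.prems(2) by (simp add: n_def)
      show "Polynomial.degree (smult c H + (\<Sum>a\<in>R. smult (w a) (K a))) \<le> n"
        using fin degK by (intro degree_add_le degree_sum_le) (auto simp: n_def[symmetric] less_imp_le intro: order.trans[OF degree_smult_le])
      fix b assume b: "b \<in> R"
      have "(\<Sum>a\<in>R. w a * poly (K a) b) = (\<Sum>a\<in>R. if a = b then poly G b else 0)"
        using Kb b Ka by (intro sum.cong) (auto simp: w_def)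
      then show "poly G b = poly (smult c H + (\<Sum>a\<in>R. smult (w a) (K a))) b"
        using b fin by (simp add: poly_sum R_def)
    qed
    have "poly G r / poly H r = c + (\<Sum>a\<in>R. w a / (r - a))" if r: "0 < r" for r
    proof -
      have Hr: "poly H r \<noteq> 0" using less.prems(4) r by blast
      have "w a * poly (K a) r / poly H r = w a / (r - a)" if a: "a \<in> R" for a
      proof -
        have "poly H r = (r - a) * poly (K a) r"
          using arg_cong[OF K[OF a], of "\<lambda>p. poly p r"] by (simp add: algebra_simps)
        then show ?thesis using Hr by simp
      qed
      then have "(\<Sum>a\<in>R. w a * poly (K a) r / poly H r) = (\<Sum>a\<in>R. w a / (r - a))"
        by (rule sum.cong[OF refl])
      then show ?thesis
        using Hr by (subst G) (simp add: poly_sum add_divide_distrib sum_divide_distrib)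
    qed
    moreover have "0 \<le> c" using less.prems(3) A by (simp add: c_def n_def)
    moreover have "a \<le> 0" if "a \<in> R" for a using neg that by (simp add: R_def)
    ultimately show ?thesis using fin w by (intro exI[of _ R] exI[of _ c] exI[of _ w]) auto
  qed
qed

text \<open>As \<open>a \<le> 0\<close> and \<open>w a \<ge> 0\<close>, each
  \<open>w a / (r - a)\<close> decreases in \<open>r\<close> while each
  \<open>r * w a / (r - a)\<close> increases.\<close>

lemma stable_quotient_mono:
  fixes G H :: "real poly"
  assumes "0 < lead_coeff H" "Polynomial.degree G \<le> Polynomial.degree H" "0 \<le> poly.coeff G (Polynomial.degree H)"
    and "\<And>r. 0 < r \<Longrightarrow> poly H r \<noteq> 0"
    and "\<And>z. 0 < Im z \<Longrightarrow> poly (cpoly H) z \<noteq> 0"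
    and "\<And>z. 0 < Im z \<Longrightarrow> Im (poly (cpoly G) z / poly (cpoly H) z) \<le> 0"
    and rs: "0 < r" "r \<le> s"
  shows "poly G s / poly H s \<le> poly G r / poly H r"
    and "r * poly G r / poly H r \<le> s * poly G s / poly H s"
proof -
  obtain R c w where R: "finite R" "\<And>a. a \<in> R \<Longrightarrow> a \<le> 0" "\<And>a. a \<in> R \<Longrightarrow> 0 \<le> w a" and c: "0 \<le> c"
    and eq: "\<And>r. 0 < r \<Longrightarrow> poly G r / poly H r = c + (\<Sum>a\<in>R. w a / (r - a))"
    using stable_quotient_partial_fractions[OF assms(1-6)] by metis
  have pos: "0 < r - a" "0 < s - a" if "a \<in> R" for a using R(2)[OF that] rs by auto
  show "poly G s / poly H s \<le> poly G r / poly H r"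
    using rs R pos by (auto simp: eq intro!: sum_mono divide_left_mono)
  have "r * (w a / (r - a)) \<le> s * (w a / (s - a))" if a: "a \<in> R" for a
  proof -
    have "r * (s - a) \<le> s * (r - a)" using mult_right_mono_neg[OF rs(2) R(2)[OF a]] by (simp add: algebra_simps)
    then have "r / (r - a) \<le> s / (s - a)" using pos[OF a] by (simp add: divide_simps)
    from mult_left_mono[OF this R(3)[OF a]] show ?thesis by (simp add: mult.commute)
  qed
  then have "r * (c + (\<Sum>a\<in>R. w a / (r - a))) \<le> s * (c + (\<Sum>a\<in>R. w a / (s - a)))"
    using rs c unfolding distrib_left sum_distrib_left by (intro add_mono sum_mono mult_right_mono) auto
  then show "r * poly G r / poly H r \<le> s * poly G s / poly H s"
    using rs by (simp add: eq flip: times_divide_eq_right)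
qed

subsection \<open>Coefficient extraction preserves stability\<close>

definition upoly :: "'a set \<Rightarrow> ('a \<Rightarrow> 'b) \<Rightarrow> ('a \<Rightarrow> nat) \<Rightarrow> 'b::comm_ring_1 poly"
  where "upoly A c d = (\<Sum>a\<in>A. monom (c a) (d a))"

lemma poly_upoly: "poly (upoly A c d) u = (\<Sum>a\<in>A. c a * u ^ d a)"
  by (simp add: upoly_def poly_sum poly_monom)

lemma pderiv_sum: "pderiv (\<Sum>a\<in>A. f a) = (\<Sum>a\<in>A. pderiv (f a))"
  by (induction A rule: infinite_finite_induct) (simp_all add: pderiv_add)

lemma poly_pderiv_upoly:
  fixes c :: "'a \<Rightarrow> 'b::{comm_ring_1, semiring_no_zero_divisors, semiring_char_0}"
  shows "poly (pderiv (upoly A c d)) u = (\<Sum>a\<in>A. c a * of_nat (d a) * u ^ (d a - 1))"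
  unfolding upoly_def pderiv_sum poly_sum
  by (intro sum.cong refl) (simp add: pderiv_monom poly_monom mult.commute)

lemma cpoly_upoly: "cpoly (upoly A c d) = upoly A (\<lambda>a. of_real (c a)) d"
  by (rule poly_eqI) (simp add: coeff_map_poly upoly_def coeff_sum coeff_monom of_real_sum if_distrib cong: if_cong)

lemma coeff_upoly: "poly.coeff (upoly A c d) k = (\<Sum>a\<in>A. if d a = k then c a else 0)"
  by (simp add: upoly_def coeff_sum coeff_monom)

lemma coeff_upoly_pos:
  fixes c :: "'a \<Rightarrow> real"
  assumes "finite A" "\<And>a. a \<in> A \<Longrightarrow> 0 \<le> c a" "a \<in> A" "0 < c a"
  shows "0 < poly.coeff (upoly A c d) (d a)"
  unfolding coeff_upoly by (rule sum_pos2[of _ a]) (use assms in auto)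

lemma upoly_lead_coeff_pos:
  fixes c :: "'a \<Rightarrow> real"
  assumes "finite A" "\<And>a. a \<in> A \<Longrightarrow> 0 \<le> c a" "a \<in> A" "0 < c a"
  shows "0 < lead_coeff (upoly A c d)"
proof -
  have "0 \<le> lead_coeff (upoly A c d)" unfolding coeff_upoly using assms by (intro sum_nonneg) auto
  moreover have "upoly A c d \<noteq> 0" using coeff_upoly_pos[of A c a d] assms by auto
  ultimately show ?thesis by (simp add: order_less_le)
qed

lemma degree_upoly_ge:
  fixes c :: "'a \<Rightarrow> real"
  assumes "finite A" "\<And>a. a \<in> A \<Longrightarrow> 0 \<le> c a" "a \<in> A" "0 < c a"
  shows "d a \<le> Polynomial.degree (upoly A c d)"
  using coeff_upoly_pos[of A c a d] assms by (intro le_degree) simp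

lemma prod_power_if:
  fixes y :: "'n::finite \<Rightarrow> 'b::comm_semiring_1"
  shows "(\<Prod>l\<in>UNIV. (if l \<in> S then u else y l) ^ e l) = u ^ sum e S * (\<Prod>l\<in>-S. y l ^ e l)"
proof -
  have "(\<Prod>l\<in>UNIV. (if l \<in> S then u else y l) ^ e l)
      = (\<Prod>l\<in>S. (if l \<in> S then u else y l) ^ e l) * (\<Prod>l\<in>-S. (if l \<in> S then u else y l) ^ e l)"
    by (subst prod.union_disjoint[symmetric]) (auto simp: Compl_partition)
  also have "(\<Prod>l\<in>S. (if l \<in> S then u else y l) ^ e l) = u ^ sum e S"
    by (simp add: power_sum)
  also have "(\<Prod>l\<in>-S. (if l \<in> S then u else y l) ^ e l) = (\<Prod>l\<in>-S. y l ^ e l)"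
    by (intro prod.cong) auto
  finally show ?thesis .
qed

lemma wsum_slice:
  "wsum A e c (\<lambda>l. if l \<in> S then u else y l)
   = poly (upoly A (\<lambda>a. of_real (c a) * (\<Prod>l\<in>-S. y l ^ e a l)) (\<lambda>a. sum (e a) S)) u"
  by (simp add: wsum_def prod_power_if poly_upoly ac_simps)

lemma Im_log_deriv_slice:
  fixes z :: "'n::finite \<Rightarrow> complex"
  assumes st: "stable_wsum A e c" and z: "\<And>l. 0 < Im (z l) \<or> (Im (z l) = 0 \<and> 0 < Re (z l))"
    and u: "0 < Im u \<or> (Im u = 0 \<and> 0 < Re u)"
  shows "Im ((\<Sum>a\<in>A. of_real (c a) * (\<Prod>l\<in>-S. z l ^ e a l) * of_nat (sum (e a) S) * u ^ (sum (e a) S - 1))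
    / wsum A e c (\<lambda>l. if l \<in> S then u else z l)) \<le> 0"
proof -
  have nz: "wsum A e c (\<lambda>l. if l \<in> S then v else z l) \<noteq> 0" if "0 < Im v \<or> (Im v = 0 \<and> 0 < Re v)" for v
  proof (rule stable_wsum_boundary[OF st])
    show "0 < Im (if l \<in> S then v else z l) \<or> (Im (if l \<in> S then v else z l) = 0 \<and> 0 < Re (if l \<in> S then v else z l))" for l
      using z[of l] that by (cases "l \<in> S") simp_all
  qed
  show ?thesis
    unfolding wsum_slice poly_pderiv_upoly[symmetric]
    by (rule Im_pderiv_quotient) (use u nz in \<open>auto simp flip: wsum_slice\<close>)
qed

text \<open>This is the partial derivative in the variable \<open>i\<close>; where
  \<open>e a i = 0\<close>, the truncated exponent comes with weight 0. Its quotient by the original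
  sum has nonpositive imaginary part and so never equals \<open>\<i> * s\<close> with
  \<open>s > 0\<close>. Hurwitz's theorem covers \<open>s = 0\<close>, where \<open>ex\<close> keeps
  the limit from vanishing identically.\<close>

lemma stable_wsum_deriv:
  assumes st: "stable_wsum A e c" and ex: "\<exists>a\<in>A. 0 < c a \<and> 0 < e a i"
  shows "stable_wsum A (\<lambda>a. (e a)(i := e a i - 1)) (\<lambda>a. c a * real (e a i))"
proof -
  define e' c' where "e' = (\<lambda>a. (e a)(i := e a i - 1))" and "c' = (\<lambda>a. c a * real (e a i))"
  have c': "0 \<le> c' a" if "a \<in> A" for a using stable_wsum_nonneg[OF st that] by (simp add: c'_def)
  have "wsum A e' c' z \<noteq> 0" if z: "\<And>l. 0 < Im (z l)" for z
  proof -
    define x y where "x = (\<lambda>l. Re (z l))" and "y = (\<lambda>l. Im (z l))"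
    define Z where "Z = (\<lambda>w::complex. (\<lambda>l. of_real (x l) + w * of_real (y l)))"
    define \<Psi> where "\<Psi> = (\<lambda>(s::real) w. wsum A e' c' (Z w) - \<i> * of_real s * wsum A e c (Z w))"
    have y: "0 < y l" for l using z by (simp add: y_def)
    obtain t where t: "\<And>l. 0 < x l + t * y l" using ex_pos_point[of y x] y by blast
    have "\<Psi> 0 \<i> \<noteq> 0"
    proof (rule hurwitz_half_plane[where \<Psi> = \<Psi> and a = "of_real t"])
      show "continuous_on UNIV (\<lambda>(s, w). \<Psi> s w)"
        unfolding \<Psi>_def wsum_def Z_def case_prod_beta by (intro continuous_intros)
      show "\<Psi> s holomorphic_on UNIV" for s
        unfolding \<Psi>_def wsum_def Z_def by (intro holomorphic_intros)
      show "\<Psi> s w \<noteq> 0" if "0 < s" "0 < Im w" for s w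
      proof
        assume 0: "\<Psi> s w = 0"
        have ImZ: "0 < Im (Z w l)" for l using that y by (simp add: Z_def)
        have nz: "wsum A e c (Z w) \<noteq> 0" using ImZ by (rule stable_wsum_nz[OF st])
        have upd: "(\<lambda>l. if l \<in> {i} then Z w i else Z w l) = Z w" by auto
        have "wsum A e' c' (Z w) = (\<Sum>a\<in>A. of_real (c a) * (\<Prod>l\<in>-{i}. Z w l ^ e a l) * of_nat (sum (e a) {i}) * Z w i ^ (sum (e a) {i} - 1))"
          unfolding wsum_def
        proof (intro sum.cong refl)
          fix a
          have "(\<Prod>l\<in>UNIV. Z w l ^ e' a l) = Z w i ^ (e a i - 1) * (\<Prod>l\<in>-{i}. Z w l ^ e a l)"
            unfolding Compl_eq_Diff_UNIV by (subst prod.remove[of _ i]) (auto simp: e'_def intro!: prod.cong)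
          then show "of_real (c' a) * (\<Prod>l\<in>UNIV. Z w l ^ e' a l)
              = of_real (c a) * (\<Prod>l\<in>-{i}. Z w l ^ e a l) * of_nat (sum (e a) {i}) * Z w i ^ (sum (e a) {i} - 1)"
            by (simp add: c'_def)
        qed
        then have "Im (wsum A e' c' (Z w) / wsum A e c (Z w)) \<le> 0"
          using Im_log_deriv_slice[OF st, of "Z w" "Z w i" "{i}"] ImZ unfolding upd by simp
        moreover have "wsum A e' c' (Z w) / wsum A e c (Z w) = \<i> * of_real s"
          using 0 nz by (simp add: \<Psi>_def)
        ultimately show False using that by simp
      qed
      have "\<Psi> 0 (of_real t) = of_real (wsum A e' c' (\<lambda>l. x l + t * y l))"
        unfolding \<Psi>_def Z_def by (subst wsum_of_real[symmetric]) simp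
      moreover have "0 < wsum A e' c' (\<lambda>l. x l + t * y l)"
        using st ex c' t by (intro wsum_pos) (force simp: c'_def stable_wsum_def)+
      ultimately show "\<Psi> 0 (of_real t) \<noteq> 0" by simp
    qed auto
    moreover have "\<Psi> 0 \<i> = wsum A e' c' z"
      unfolding \<Psi>_def Z_def x_def y_def by (simp add: complex_eq[symmetric])
    ultimately show ?thesis by simp
  qed
  then show ?thesis
    using st c' by (simp add: stable_wsum_def e'_def c'_def)
qed

lemma wsum_upd_zero:
  assumes "finite A"
  shows "wsum A e c (z(i := 0)) = wsum {a \<in> A. e a i = 0} e c z"
proof -
  have pr: "(\<Prod>l\<in>UNIV. (z(i := 0)) l ^ e a l) = (if e a i = 0 then (\<Prod>l\<in>UNIV. z l ^ e a l) else 0)" for a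
  proof (cases "e a i = 0")
    case True
    then show ?thesis by (auto intro!: prod.cong)
  next
    case False
    then show ?thesis by (auto intro!: prod_zero bexI[of _ i] simp: power_0_left)
  qed
  show ?thesis
    unfolding wsum_def sum.inter_filter[OF assms] pr by (intro sum.cong refl) auto
qed

text \<open>The filter amounts to setting the variable \<open>i\<close> to 0, the limit of the
  admissible values \<open>\<i> * s\<close>.\<close>

lemma stable_wsum_filter_zero:
  assumes st: "stable_wsum A e c" and ex: "\<exists>a\<in>A. 0 < c a \<and> e a i = 0"
  shows "stable_wsum {a \<in> A. e a i = 0} e c"
proof -
  have fin: "finite A" using st by (rule stable_wsum_finite)
  have "wsum {a \<in> A. e a i = 0} e c z \<noteq> 0" if z: "\<And>l. 0 < Im (z l)" for z
  proof -
    define x y where "x = (\<lambda>l. Re (z l))" and "y = (\<lambda>l. Im (z l))"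
    define \<Psi> where "\<Psi> = (\<lambda>(s::real) w. wsum A e c (\<lambda>l. if l = i then \<i> * of_real s else of_real (x l) + w * of_real (y l)))"
    have y: "0 < y l" for l using z by (simp add: y_def)
    obtain t where t: "\<And>l. 0 < x l + t * y l" using ex_pos_point[of y x] y by blast
    have \<Psi>0: "\<Psi> 0 w = wsum {a \<in> A. e a i = 0} e c (\<lambda>l. of_real (x l) + w * of_real (y l))" for w
      unfolding wsum_upd_zero[OF fin, symmetric] \<Psi>_def by (rule arg_cong[where f = "wsum A e c"]) auto
    have "\<Psi> 0 \<i> \<noteq> 0"
    proof (rule hurwitz_half_plane[where \<Psi> = \<Psi> and a = "of_real t"])
      have cont: "continuous_on UNIV (\<lambda>p. if l = i then \<i> * of_real (fst p) else of_real (x l) + snd p * of_real (y l))" for l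
        by (cases "l = i") (auto intro!: continuous_intros)
      show "continuous_on UNIV (\<lambda>(s, w). \<Psi> s w)"
        unfolding \<Psi>_def wsum_def case_prod_beta by (intro continuous_intros cont)
      have holo: "(\<lambda>w. if l = i then \<i> * of_real s else of_real (x l) + w * of_real (y l)) holomorphic_on UNIV" for l s
        by (cases "l = i") (auto intro!: holomorphic_intros)
      show "\<Psi> s holomorphic_on UNIV" for s
        unfolding \<Psi>_def wsum_def by (intro holomorphic_intros holo)
      show "\<Psi> s w \<noteq> 0" if "0 < s" "0 < Im w" for s w
        unfolding \<Psi>_def using that y by (intro stable_wsum_nz[OF st]) auto
      have "\<Psi> 0 (of_real t) = of_real (wsum {a \<in> A. e a i = 0} e c (\<lambda>l. x l + t * y l))"
        unfolding \<Psi>0 by (subst wsum_of_real[symmetric]) simp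
      moreover have "0 < wsum {a \<in> A. e a i = 0} e c (\<lambda>l. x l + t * y l)"
        using st ex t by (intro wsum_pos) (auto simp: stable_wsum_def)
      ultimately show "\<Psi> 0 (of_real t) \<noteq> 0" by simp
    qed auto
    moreover have "\<Psi> 0 \<i> = wsum {a \<in> A. e a i = 0} e c z"
      unfolding \<Psi>0 x_def y_def by (simp add: complex_eq[symmetric])
    ultimately show ?thesis by simp
  qed
  then show ?thesis using st by (simp add: stable_wsum_def)
qed

text \<open>Differentiating \<open>k\<close> times in the variable \<open>i\<close> and then setting
  it to 0 isolates the terms with exponent \<open>k\<close>, up to a positive constant and a power
  of \<open>z i\<close>.\<close>

lemma stable_wsum_filter:
  assumes "stable_wsum A e c" "\<exists>a\<in>A. 0 < c a \<and> e a i = k"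
  shows "stable_wsum {a \<in> A. e a i = k} e c"
  using assms
proof (induction k arbitrary: e c)
  case 0
  then show ?case by (rule stable_wsum_filter_zero)
next
  case (Suc k)
  define e' c' where "e' = (\<lambda>a. (e a)(i := e a i - 1))" and "c' = (\<lambda>a. c a * real (e a i))"
  have "stable_wsum A e' c'"
    unfolding e'_def c'_def using Suc.prems(2) by (intro stable_wsum_deriv[OF Suc.prems(1)]) force
  then have st': "stable_wsum {a \<in> A. e' a i = k} e' c'"
  proof (rule Suc.IH)
    show "\<exists>a\<in>A. 0 < c' a \<and> e' a i = k" using Suc.prems(2) by (force simp: e'_def c'_def)
  qed
  have fin: "finite A" using Suc.prems(1) by (rule stable_wsum_finite)
  have "wsum {a \<in> A. e a i = Suc k} e c z \<noteq> 0" if z: "\<And>l. 0 < Im (z l)" for z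
  proof -
    \<comment> \<open>For \<open>k = 0\<close> the left filter also admits indices with
      \<open>e a i = 0\<close>, but their weight \<open>c' a\<close> is 0.\<close>
    have "z i * wsum {a \<in> A. e' a i = k} e' c' z = z i * wsum {a \<in> A. e a i = Suc k} e' c' z"
      unfolding wsum_def using fin
      by (intro arg_cong[where f = "(*) (z i)"] sum.mono_neutral_right) (auto simp: e'_def c'_def)
    also have "\<dots> = of_nat (Suc k) * wsum {a \<in> A. e a i = Suc k} e c z"
      unfolding wsum_def sum_distrib_left
    proof (intro sum.cong refl)
      fix a assume "a \<in> {a \<in> A. e a i = Suc k}"
      then have a: "e a i = Suc k" by simp
      have "(\<Prod>l\<in>UNIV. z l ^ e a l) = z i * (\<Prod>l\<in>UNIV. z l ^ e' a l)"
        by (subst (1 2) prod.remove[of _ i]) (auto simp: e'_def a intro!: prod.cong)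
      then show "z i * (of_real (c' a) * (\<Prod>l\<in>UNIV. z l ^ e' a l)) = of_nat (Suc k) * (of_real (c a) * (\<Prod>l\<in>UNIV. z l ^ e a l))"
        by (simp add: c'_def a algebra_simps)
    qed
    finally have "of_nat (Suc k) * wsum {a \<in> A. e a i = Suc k} e c z = z i * wsum {a \<in> A. e' a i = k} e' c' z" ..
    moreover have "z i \<noteq> 0" using z[of i] by auto
    ultimately show ?thesis using stable_wsum_nz[OF st', of z] z by auto
  qed
  then show ?case using Suc.prems(1) by (simp add: stable_wsum_def)
qed

subsection \<open>Scaling a set of variables\<close>

text \<open>A stage of the walk is thereby absorbed into the weights, and the next one starts again
  from the point of all ones.\<close>

lemma wsum_scale:
  "wsum A e (\<lambda>a. c a * t ^ sum (e a) S) z = wsum A e c (\<lambda>i. if i \<in> S then of_real t * z i else z i)"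
  unfolding wsum_def
proof (intro sum.cong refl)
  fix a
  have "(\<Prod>i\<in>UNIV. (if i \<in> S then of_real t * z i else z i) ^ e a i)
      = (\<Prod>i\<in>UNIV. (if i \<in> S then of_real t else 1) ^ e a i * z i ^ e a i)"
    by (intro prod.cong) (auto simp: power_mult_distrib)
  also have "\<dots> = of_real t ^ sum (e a) S * (\<Prod>i\<in>UNIV. z i ^ e a i)"
    by (simp add: prod.distrib prod_power_if)
  finally show "of_real (c a * t ^ sum (e a) S) * (\<Prod>i\<in>UNIV. z i ^ e a i)
      = of_real (c a) * (\<Prod>i\<in>UNIV. (if i \<in> S then of_real t * z i else z i) ^ e a i)"
    by (simp add: mult.assoc)
qed

lemma stable_wsum_scale:
  assumes st: "stable_wsum A e c" and t: "0 < t"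
  shows "stable_wsum A e (\<lambda>a. c a * t ^ sum (e a) S)"
proof -
  have "wsum A e (\<lambda>a. c a * t ^ sum (e a) S) z \<noteq> 0" if "\<And>i. 0 < Im (z i)" for z :: "'b \<Rightarrow> complex"
    unfolding wsum_scale using that t by (intro stable_wsum_nz[OF st]) auto
  then show ?thesis using st t by (auto simp: stable_wsum_def)
qed

text \<open>Collects what the factorization and the monotonicity of quotients require of a slice
  through a positive point.\<close>

lemma stable_upoly_slice:
  fixes x :: "'n::finite \<Rightarrow> real" and S :: "'n set"
  assumes st: "stable_wsum A e c" and x: "\<And>i. 0 < x i"
  defines "H \<equiv> upoly A (\<lambda>a. c a * (\<Prod>l\<in>-S. x l ^ e a l)) (\<lambda>a. sum (e a) S)"
  shows "0 < lead_coeff H" "\<And>r. 0 < r \<Longrightarrow> 0 < poly H r" "\<And>z. 0 < Im z \<Longrightarrow> poly (cpoly H) z \<noteq> 0"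
    and "\<And>u. poly (cpoly H) u = wsum A e c (\<lambda>l. if l \<in> S then u else of_real (x l))"
proof -
  have pp: "0 < (\<Prod>l\<in>-S. x l ^ e a l)" for a using x by (intro prod_pos) auto
  show "0 < lead_coeff H"
  proof -
    obtain a where "a \<in> A" "0 < c a" using stable_wsum_ex_pos[OF st] by blast
    then show ?thesis
      unfolding H_def using pp stable_wsum_nonneg[OF st] stable_wsum_finite[OF st]
      by (intro upoly_lead_coeff_pos[of _ _ a]) (auto simp: less_imp_le)
  qed
  show "0 < poly H r" if "0 < r" for r
  proof -
    have "poly H r = wsum A e c (\<lambda>l. if l \<in> S then r else x l)"
      by (simp add: H_def wsum_slice)
    also have "\<dots> > 0" using that x by (intro stable_wsum_pos[OF st]) auto
    finally show ?thesis .
  qed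
  show cH: "poly (cpoly H) u = wsum A e c (\<lambda>l. if l \<in> S then u else of_real (x l))" for u
    by (simp add: H_def cpoly_upoly wsum_slice)
  show "poly (cpoly H) z \<noteq> 0" if "0 < Im z" for z
    unfolding cH by (rule stable_wsum_boundary[OF st]) (use that x in auto)
qed

text \<open>An instance of \<open>prod_linear_lower_bound\<close>: the slice through the point of
  all ones has the total weight as its value at 1, and its derivative there is the unnormalised mean
  of \<open>sum (e a) S\<close>.\<close>

lemma stable_scale_growth:
  assumes st: "stable_wsum A e c" and t: "0 < t"
  shows "t ^ k * (sum c A + ((\<Sum>a\<in>A. c a * real (sum (e a) S)) - real k * sum c A) * (t - 1))
    \<le> (\<Sum>a\<in>A. c a * t ^ sum (e a) S)"
proof -
  define H where "H = upoly A c (\<lambda>a. sum (e a) S)"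
  note H = stable_upoly_slice[OF st, where x = "\<lambda>_. 1" and S = S, simplified, folded H_def]
  obtain M where "H = smult (lead_coeff H) (\<Prod>\<rho>\<in>#M. [:\<rho>, 1:])" "\<And>\<rho>. \<rho> \<in># M \<Longrightarrow> 0 \<le> \<rho>"
    using H(1-3) by (elim stable_poly_factorization[rotated -1]) force+
  from prod_linear_lower_bound[OF this(1) H(1) this(2) t, of k] show ?thesis
    by (simp add: H_def poly_upoly poly_pderiv_upoly)
qed

text \<open>\<open>mean t\<close> is the mean exponent of \<open>T\<close> after scaling
  \<open>S\<close> by \<open>t\<close>. It has the form \<open>G / H\<close> if \<open>T\<close> is
  disjoint from \<open>S\<close>, and \<open>t * G / H\<close> if \<open>T\<close> is contained in
  \<open>S\<close>; the two claims of \<open>stable_quotient_mono\<close> apply.\<close>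

lemma stable_mean_mono:
  fixes S T :: "'n::finite set"
  assumes st: "stable_wsum A e c" and rs: "0 < r" "r \<le> s"
  defines "mean \<equiv> \<lambda>t. (\<Sum>a\<in>A. c a * real (sum (e a) T) * t ^ sum (e a) S) / (\<Sum>a\<in>A. c a * t ^ sum (e a) S)"
  shows stable_mean_mono_subset: "T \<subseteq> S \<Longrightarrow> mean r \<le> mean s"
    and stable_mean_mono_disjoint: "T \<inter> S = {} \<Longrightarrow> mean s \<le> mean r"
proof -
  define H where "H = upoly A c (\<lambda>a. sum (e a) S)"
  note H = stable_upoly_slice[OF st, where x = "\<lambda>_. 1" and S = S, simplified, folded H_def]
  have fin: "finite A" and c0: "\<And>a. a \<in> A \<Longrightarrow> 0 \<le> c a"
    using st by (auto simp: stable_wsum_def)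
  \<comment> \<open>Nonnegative weights cannot cancel, so the degree bounds every exponent of
    nonzero weight.\<close>
  have deg: "sum (e a) S \<le> Polynomial.degree H" if "a \<in> A" "c a \<noteq> 0" for a
    unfolding H_def using that fin c0[OF that(1)] c0 by (intro degree_upoly_ge) (auto simp: order_less_le)
  define G where "G = (\<lambda>d. upoly A (\<lambda>a. c a * real (sum (e a) T)) d)"
  have degG: "Polynomial.degree (G d) \<le> Polynomial.degree H" if "\<And>a. d a \<le> sum (e a) S" for d
    unfolding G_def upoly_def
  proof (intro degree_sum_le fin)
    fix a assume a: "a \<in> A"
    show "Polynomial.degree (monom (c a * real (sum (e a) T)) (d a)) \<le> Polynomial.degree H"
    proof (cases "c a = 0")
      case False
      then show ?thesis using deg[OF a] that[of a] degree_monom_le order.trans by meson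
    qed simp
  qed
  have coeffG: "0 \<le> poly.coeff (G d) k" for d k
    unfolding G_def coeff_upoly using c0 by (auto intro!: sum_nonneg mult_nonneg_nonneg)
  define Z where "Z = (\<lambda>z l. if l \<in> S then z else (1::complex))"
  have Z: "0 < Im (Z z l) \<or> (Im (Z z l) = 0 \<and> 0 < Re (Z z l))" if "0 < Im z" for z l
    using that by (simp add: Z_def)
  show "mean r \<le> mean s" if TS: "T \<subseteq> S"
  proof -
    \<comment> \<open>Differentiating in the variables of \<open>T\<close> costs one power. At
      \<open>sum (e a) S = 0\<close> the truncation is harmless, as the weight then contains the
      factor \<open>sum (e a) T = 0\<close>.\<close>
    define d where "d = (\<lambda>a. sum (e a) S - 1)"
    have split: "sum (e a) S = sum (e a) T + sum (e a) (S - T)" for a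
      using TS by (metis add.commute finite sum.subset_diff)
    have Im: "Im (poly (cpoly (G d)) z / poly (cpoly H) z) \<le> 0" if z: "0 < Im z" for z
    proof -
      have eq: "of_real (c a) * (\<Prod>l\<in>-T. Z z l ^ e a l) * of_nat (sum (e a) T) * z ^ (sum (e a) T - 1)
          = of_real (c a * real (sum (e a) T)) * z ^ d a" for a
      proof (cases "sum (e a) T = 0")
        case False
        have "(\<Prod>l\<in>-T. Z z l ^ e a l) = (\<Prod>l\<in>S - T. z ^ e a l)"
          by (rule prod.mono_neutral_cong_right) (auto simp: Z_def)
        moreover have "d a = sum (e a) (S - T) + (sum (e a) T - 1)" using False split[of a] unfolding d_def by linarith
        ultimately show ?thesis by (simp add: power_add power_sum)
      qed auto
      have "(\<lambda>l. if l \<in> T then z else Z z l) = (\<lambda>l. if l \<in> S then z else 1)" using TS by (auto simp: Z_def fun_eq_iff)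
      then show ?thesis
        using Im_log_deriv_slice[OF st, where z = "Z z" and u = z and S = T] Z[OF z] z unfolding eq
        by (simp add: G_def cpoly_upoly poly_upoly H(4) cong: if_cong)
    qed
    have "t * poly (G d) t / poly H t = mean t" for t
    proof -
      have "t * poly (G d) t = (\<Sum>a\<in>A. c a * real (sum (e a) T) * t ^ sum (e a) S)"
        unfolding G_def poly_upoly sum_distrib_left
      proof (intro sum.cong refl)
        fix a
        show "t * (c a * real (sum (e a) T) * t ^ d a) = c a * real (sum (e a) T) * t ^ sum (e a) S"
        proof (cases "sum (e a) S")
          case 0
          then show ?thesis using split[of a] by simp
        qed (simp add: d_def)
      qed
      then show ?thesis by (simp add: mean_def H_def poly_upoly)
    qed
    moreover have "r * poly (G d) r / poly H r \<le> s * poly (G d) s / poly H s"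
      using H(1-3) Im coeffG rs by (intro stable_quotient_mono(2) degG) (auto simp: d_def less_imp_neq[symmetric])
    ultimately show ?thesis by simp
  qed
  show "mean s \<le> mean r" if TS: "T \<inter> S = {}"
  proof -
    define d where "d = (\<lambda>a. sum (e a) S)"
    have Im: "Im (poly (cpoly (G d)) z / poly (cpoly H) z) \<le> 0" if z: "0 < Im z" for z
    proof -
      have "(\<Prod>l\<in>-T. Z z l ^ e a l) = (\<Prod>l\<in>S. z ^ e a l)" for a
        by (rule prod.mono_neutral_cong_right) (use TS in \<open>auto simp: Z_def\<close>)
      then have eq: "(\<Prod>l\<in>-T. Z z l ^ e a l) = z ^ d a" for a by (simp add: d_def power_sum)
      \<comment> \<open>Here the derivative is taken in the variables of \<open>T\<close> at the
        value 1, while \<open>z\<close> occupies those of \<open>S\<close>.\<close>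
      have "(\<lambda>l. if l \<in> T then 1 else Z z l) = (\<lambda>l. if l \<in> S then z else 1)" using TS by (auto simp: Z_def fun_eq_iff)
      then show ?thesis
        using Im_log_deriv_slice[OF st, where z = "Z z" and u = 1 and S = T] Z[OF z] unfolding eq
        by (simp add: G_def cpoly_upoly poly_upoly H(4) ac_simps cong: if_cong)
    qed
    have "poly (G d) t / poly H t = mean t" for t
      by (simp add: mean_def G_def H_def poly_upoly d_def)
    moreover have "poly (G d) s / poly H s \<le> poly (G d) r / poly H r"
      using H(1-3) Im coeffG rs by (intro stable_quotient_mono(1) degG) (auto simp: d_def less_imp_neq[symmetric])
    ultimately show ?thesis by simp
  qed
qed

subsection \<open>The capacity bound\<close>

text \<open>Only level sets of \<open>y\<close> occur in the hypotheses, because every stage scales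
  a level set: too small a mean is harmful above 1, too large a mean below 1. The induction is on
  the number of coordinates different from 1; dividing by \<open>sum c A\<close> accommodates the
  changing weights.\<close>

theorem stable_wsum_capacity:
  fixes y :: "'n::finite \<Rightarrow> real" and \<kappa> :: "'n \<Rightarrow> nat"
  assumes "stable_wsum A e c" "\<And>i. 0 < y i" and \<delta>: "0 \<le> \<delta>" "\<delta> < 1"
    and "\<And>\<theta>. 1 < \<theta> \<Longrightarrow> real (sum \<kappa> {i. \<theta> \<le> y i}) - \<delta> \<le> (\<Sum>a\<in>A. c a * real (sum (e a) {i. \<theta> \<le> y i})) / sum c A"
    and "\<And>\<theta>. \<theta> < 1 \<Longrightarrow> (\<Sum>a\<in>A. c a * real (sum (e a) {i. y i \<le> \<theta>})) / sum c A \<le> real (sum \<kappa> {i. y i \<le> \<theta>}) + \<delta>"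
  shows "sum c A * (1 - \<delta>) ^ card {i. y i \<noteq> 1} * (\<Prod>i\<in>UNIV. y i ^ \<kappa> i) \<le> wsum A e c y"
  using assms(1,2,5,6)
proof (induction "card {i. y i \<noteq> 1}" arbitrary: y c rule: less_induct)
  case less
  note st = less.prems(1) and ypos = less.prems(2) and up = less.prems(3) and down = less.prems(4)
  define Z where "Z = sum c A"
  have Z: "0 < Z"
    using stable_wsum_pos[OF st, of "\<lambda>_. 1"] by (simp add: wsum_def Z_def)
  \<comment> \<open>One stage divides \<open>y\<close> by \<open>v\<close> on \<open>S\<close> and
    moves the factor into the weights. \<open>growth\<close> pays a single factor
    \<open>1 - \<delta>\<close>; \<open>up'\<close> and \<open>down'\<close> identify the new level
    sets with old ones that lie on the favourable side of \<open>S\<close>.\<close>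
  have step: ?case
    if v: "0 < v" "i0 \<in> S" "y i0 = v" "v \<noteq> 1" "\<And>i. y i = 1 \<Longrightarrow> i \<notin> S"
      and growth: "Z * v ^ sum \<kappa> S * (1 - \<delta>) \<le> (\<Sum>a\<in>A. c a * v ^ sum (e a) S)"
      and up': "\<And>\<theta>. 1 < \<theta> \<Longrightarrow> \<exists>\<eta>>1. {i. \<theta> \<le> (if i \<in> S then y i / v else y i)} = {i. \<eta> \<le> y i} \<and>
        (if 1 < v then {i. \<eta> \<le> y i} \<subseteq> S else {i. \<eta> \<le> y i} \<inter> S = {})"
      and down': "\<And>\<theta>. \<theta> < 1 \<Longrightarrow> \<exists>\<eta><1. {i. (if i \<in> S then y i / v else y i) \<le> \<theta>} = {i. y i \<le> \<eta>} \<and>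
        (if 1 < v then {i. y i \<le> \<eta>} \<inter> S = {} else {i. y i \<le> \<eta>} \<subseteq> S)"
    for v S i0
  proof -
    define y' where "y' = (\<lambda>i. if i \<in> S then y i / v else y i)"
    define c' where "c' = (\<lambda>a. c a * v ^ sum (e a) S)"
    have st': "stable_wsum A e c'" unfolding c'_def using st v(1) by (rule stable_wsum_scale)
    have y'pos: "0 < y' i" for i using ypos v(1) by (simp add: y'_def)
    have sub: "{i. y' i \<noteq> 1} \<subset> {i. y i \<noteq> 1}"
      using v by (auto simp: y'_def)
    then have card: "card {i. y' i \<noteq> 1} < card {i. y i \<noteq> 1}" by (intro psubset_card_mono) auto
    let ?mean = "\<lambda>T t. (\<Sum>a\<in>A. c a * real (sum (e a) T) * t ^ sum (e a) S) / (\<Sum>a\<in>A. c a * t ^ sum (e a) S)"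
    have mean': "(\<Sum>a\<in>A. c' a * real (sum (e a) T)) / sum c' A = ?mean T v" for T
      by (simp add: c'_def ac_simps)
    have mean1: "(\<Sum>a\<in>A. c a * real (sum (e a) T)) / sum c A = ?mean T 1" for T by simp
    have up1: "real (sum \<kappa> {i. \<theta> \<le> y' i}) - \<delta> \<le> (\<Sum>a\<in>A. c' a * real (sum (e a) {i. \<theta> \<le> y' i})) / sum c' A"
      if \<theta>: "1 < \<theta>" for \<theta>
    proof -
      obtain \<eta> where \<eta>: "1 < \<eta>" "{i. \<theta> \<le> y' i} = {i. \<eta> \<le> y i}"
        "if 1 < v then {i. \<eta> \<le> y i} \<subseteq> S else {i. \<eta> \<le> y i} \<inter> S = {}"
        using up'[OF \<theta>] unfolding y'_def by blast
      \<comment> \<open>Scaling by \<open>v > 1\<close> raises the means of sets inside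
        \<open>S\<close>; scaling by \<open>v < 1\<close> raises those of sets disjoint from
        \<open>S\<close>.\<close>
      have "?mean {i. \<eta> \<le> y i} 1 \<le> ?mean {i. \<eta> \<le> y i} v"
        using stable_mean_mono_subset[OF st, of 1 v "{i. \<eta> \<le> y i}" S]
          stable_mean_mono_disjoint[OF st, of v 1 "{i. \<eta> \<le> y i}" S] \<eta>(3) v(1,4)
        by (cases "1 < v") auto
      then show ?thesis using up[OF \<eta>(1)] unfolding \<eta>(2) mean' mean1 by linarith
    qed
    have down1: "(\<Sum>a\<in>A. c' a * real (sum (e a) {i. y' i \<le> \<theta>})) / sum c' A \<le> real (sum \<kappa> {i. y' i \<le> \<theta>}) + \<delta>"
      if \<theta>: "\<theta> < 1" for \<theta>
    proof -
      obtain \<eta> where \<eta>: "\<eta> < 1" "{i. y' i \<le> \<theta>} = {i. y i \<le> \<eta>}"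
        "if 1 < v then {i. y i \<le> \<eta>} \<inter> S = {} else {i. y i \<le> \<eta>} \<subseteq> S"
        using down'[OF \<theta>] unfolding y'_def by blast
      have "?mean {i. y i \<le> \<eta>} v \<le> ?mean {i. y i \<le> \<eta>} 1"
        using stable_mean_mono_disjoint[OF st, of 1 v "{i. y i \<le> \<eta>}" S]
          stable_mean_mono_subset[OF st, of v 1 "{i. y i \<le> \<eta>}" S] \<eta>(3) v(1,4)
        by (cases "1 < v") auto
      then show ?thesis using down[OF \<eta>(1)] unfolding \<eta>(2) mean' mean1 by linarith
    qed
    have IH: "sum c' A * (1 - \<delta>) ^ card {i. y' i \<noteq> 1} * (\<Prod>i\<in>UNIV. y' i ^ \<kappa> i) \<le> wsum A e c' y'"
      by (rule less.hyps[OF card st' y'pos up1 down1])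
    have "y = (\<lambda>i. if i \<in> S then v * y' i else y' i)" using v(1) by (auto simp: y'_def)
    then have wy: "wsum A e c' y' = wsum A e c y" by (simp add: c'_def wsum_scale cong: if_cong)
    have "(\<Prod>i\<in>UNIV. y i ^ \<kappa> i) = (\<Prod>i\<in>UNIV. (if i \<in> S then v else 1) ^ \<kappa> i * y' i ^ \<kappa> i)"
      using v(1) by (intro prod.cong) (auto simp: y'_def power_divide)
    then have py: "(\<Prod>i\<in>UNIV. y i ^ \<kappa> i) = v ^ sum \<kappa> S * (\<Prod>i\<in>UNIV. y' i ^ \<kappa> i)"
      by (simp add: prod.distrib prod_power_if)
    have py': "0 \<le> (\<Prod>i\<in>UNIV. y' i ^ \<kappa> i)" using y'pos by (intro prod_nonneg) (auto simp: less_imp_le)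
    obtain m where m: "card {i. y i \<noteq> 1} = Suc m" "card {i. y' i \<noteq> 1} \<le> m"
      using card by (metis less_Suc_eq_le not0_implies_Suc not_less0)
    have "Z * (1 - \<delta>) ^ Suc m * (v ^ sum \<kappa> S * (\<Prod>i\<in>UNIV. y' i ^ \<kappa> i))
        = (Z * v ^ sum \<kappa> S * (1 - \<delta>)) * ((1 - \<delta>) ^ m * (\<Prod>i\<in>UNIV. y' i ^ \<kappa> i))" by simp
    also have "\<dots> \<le> sum c' A * ((1 - \<delta>) ^ m * (\<Prod>i\<in>UNIV. y' i ^ \<kappa> i))"
      using growth \<delta> py' by (intro mult_right_mono) (auto simp: c'_def)
    also have "\<dots> \<le> sum c' A * ((1 - \<delta>) ^ card {i. y' i \<noteq> 1} * (\<Prod>i\<in>UNIV. y' i ^ \<kappa> i))"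
      using \<delta> m py' stable_wsum_nonneg[OF st']
      by (intro mult_left_mono mult_right_mono power_decreasing sum_nonneg) auto
    also have "\<dots> \<le> wsum A e c y" using IH by (simp add: wy mult.assoc)
    finally show ?thesis by (simp add: m(1) py Z_def)
  qed
  have growth: "v ^ k * (Z + ((\<Sum>a\<in>A. c a * real (sum (e a) S)) - real k * Z) * (v - 1)) \<le> (\<Sum>a\<in>A. c a * v ^ sum (e a) S)"
    if "0 < v" for v k S
    using stable_scale_growth[OF st that] by (simp add: Z_def)
  consider "\<forall>i. y i = 1" | "\<exists>i. 1 < y i" | "\<forall>i. y i \<le> 1" "\<exists>i. y i < 1"
    by (meson linorder_less_linear not_le)
  then show ?case
  proof cases
    case 1
    then show ?thesis by (simp add: wsum_def)
  next
    case 2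
    define S where "S = {i. 1 < y i}"
    define v where "v = Min (y ` S)"
    have "v \<in> y ` S" unfolding v_def using 2 by (intro Min_in) (auto simp: S_def)
    then obtain i0 where i0: "i0 \<in> S" "y i0 = v" by auto
    have v: "1 < v" using i0 by (auto simp: S_def)
    have vS: "v \<le> y i" if "i \<in> S" for i unfolding v_def using that by (intro Min_le) auto
    have Sv: "S = {i. v \<le> y i}" using vS v by (auto simp: S_def)
    define \<mu> where "\<mu> = (\<Sum>a\<in>A. c a * real (sum (e a) S))"
    define k where "k = sum \<kappa> S"
    have \<mu>: "(real k - \<delta>) * Z \<le> \<mu>" using up[OF v] Z by (simp add: Sv[symmetric] \<mu>_def k_def Z_def field_simps)
    have \<mu>0: "0 \<le> \<mu>" unfolding \<mu>_def using stable_wsum_nonneg[OF st] by (auto intro!: sum_nonneg mult_nonneg_nonneg)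
    \<comment> \<open>With mean at least \<open>k - \<delta>\<close>, the line through degrees
      \<open>k - 1\<close> and \<open>k\<close> gives
      \<open>1 + (1 - \<delta>) * (v - 1) \<ge> (1 - \<delta>) * v\<close>. For \<open>k = 0\<close>
      a nonnegative mean is enough.\<close>
    have gr: "Z * v ^ k * (1 - \<delta>) \<le> (\<Sum>a\<in>A. c a * v ^ sum (e a) S)"
    proof (cases k)
      case 0
      have "Z * (1 - \<delta>) \<le> Z * 1" using Z \<delta> by (intro mult_left_mono) auto
      also have "\<dots> \<le> Z + \<mu> * (v - 1)" using \<mu>0 v by simp
      also have "\<dots> \<le> (\<Sum>a\<in>A. c a * v ^ sum (e a) S)" using growth[of v 0 S] v by (simp add: \<mu>_def)
      finally show ?thesis by (simp add: 0)
    next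
      case (Suc l)
      have "(1 - \<delta>) * Z * (v - 1) \<le> (\<mu> - real l * Z) * (v - 1)"
        using \<mu> v by (intro mult_right_mono) (auto simp: Suc algebra_simps)
      moreover have "0 \<le> \<delta> * Z" using \<delta> Z by simp
      ultimately have "Z * (1 - \<delta>) * v \<le> Z + (\<mu> - real l * Z) * (v - 1)" by (simp add: algebra_simps)
      then have "v ^ l * (Z * (1 - \<delta>) * v) \<le> v ^ l * (Z + (\<mu> - real l * Z) * (v - 1))"
        using v by (intro mult_left_mono) auto
      also have "\<dots> \<le> (\<Sum>a\<in>A. c a * v ^ sum (e a) S)" using growth[of v l S] v by (simp add: \<mu>_def)
      finally show ?thesis by (simp add: Suc ac_simps)
    qed
    show ?thesis
    proof (rule step[of v i0 S])
      show "Z * v ^ sum \<kappa> S * (1 - \<delta>) \<le> (\<Sum>a\<in>A. c a * v ^ sum (e a) S)" using gr by (simp add: k_def)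
      show "\<exists>\<eta>>1. {i. \<theta> \<le> (if i \<in> S then y i / v else y i)} = {i. \<eta> \<le> y i} \<and>
        (if 1 < v then {i. \<eta> \<le> y i} \<subseteq> S else {i. \<eta> \<le> y i} \<inter> S = {})" if \<theta>: "1 < \<theta>" for \<theta>
      \<comment> \<open>Coordinates outside \<open>S\<close> are at most 1, so only those in
        \<open>S\<close> reach \<open>\<theta>\<close>, and they have been divided by
        \<open>v\<close>.\<close>
      proof (intro exI[of _ "\<theta> * v"] conjI)
        show \<eta>: "1 < \<theta> * v" using \<theta> v by (simp add: less_1_mult)
        have "\<theta> \<le> y i / v \<longleftrightarrow> \<theta> * v \<le> y i" for i using v by (simp add: field_simps)
        moreover have "\<not> \<theta> \<le> y i" "\<not> \<theta> * v \<le> y i" if "i \<notin> S" for i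
          using that \<theta> \<eta> by (auto simp: S_def)
        ultimately show "{i. \<theta> \<le> (if i \<in> S then y i / v else y i)} = {i. \<theta> * v \<le> y i}" by auto
        show "if 1 < v then {i. \<theta> * v \<le> y i} \<subseteq> S else {i. \<theta> * v \<le> y i} \<inter> S = {}"
          using v \<eta> by (auto simp: S_def)
      qed
      show "\<exists>\<eta><1. {i. (if i \<in> S then y i / v else y i) \<le> \<theta>} = {i. y i \<le> \<eta>} \<and>
        (if 1 < v then {i. y i \<le> \<eta>} \<inter> S = {} else {i. y i \<le> \<eta>} \<subseteq> S)" if \<theta>: "\<theta> < 1" for \<theta>
      \<comment> \<open>As \<open>v\<close> is the least value on \<open>S\<close>, the divided
        coordinates stay at least 1 and the lower level sets are unchanged.\<close>
      proof (intro exI[of _ \<theta>] conjI)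
        have "\<not> y i / v \<le> \<theta>" "\<not> y i \<le> \<theta>" if "i \<in> S" for i
        proof -
          have "1 \<le> y i / v" using vS[OF that] v by simp
          then show "\<not> y i / v \<le> \<theta>" using \<theta> by simp
          show "\<not> y i \<le> \<theta>" using that \<theta> by (auto simp: S_def)
        qed
        then show "{i. (if i \<in> S then y i / v else y i) \<le> \<theta>} = {i. y i \<le> \<theta>}"
          "if 1 < v then {i. y i \<le> \<theta>} \<inter> S = {} else {i. y i \<le> \<theta>} \<subseteq> S"
          using v by (auto split: if_splits)
      qed (rule \<theta>)
    qed (use i0 v in \<open>auto simp: S_def\<close>)
  next
    case 3
    define S where "S = {i. y i < 1}"
    define v where "v = Max (y ` S)"
    have "v \<in> y ` S" unfolding v_def using 3 by (intro Max_in) (auto simp: S_def)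
    then obtain i0 where i0: "i0 \<in> S" "y i0 = v" by auto
    have v: "0 < v" "v < 1" using i0 ypos by (auto simp: S_def)
    have vS: "y i \<le> v" if "i \<in> S" for i unfolding v_def using that by (intro Max_ge) auto
    have Sv: "S = {i. y i \<le> v}" using vS v by (auto simp: S_def)
    define \<mu> where "\<mu> = (\<Sum>a\<in>A. c a * real (sum (e a) S))"
    define k where "k = sum \<kappa> S"
    have \<mu>: "\<mu> \<le> (real k + \<delta>) * Z"
      using down[OF v(2)] Z by (simp add: Sv[symmetric] \<mu>_def k_def Z_def field_simps)
    \<comment> \<open>With mean at most \<open>k + \<delta>\<close> and \<open>v < 1\<close>, the
      line through degrees \<open>k\<close> and \<open>k + 1\<close> gives
      \<open>1 + \<delta> * (v - 1) \<ge> 1 - \<delta>\<close>.\<close>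
    have "\<delta> * Z * (v - 1) \<le> (\<mu> - real k * Z) * (v - 1)"
      using \<mu> v by (intro mult_right_mono_neg) (auto simp: algebra_simps)
    moreover have "0 \<le> \<delta> * Z * v" using \<delta> Z v by simp
    ultimately have "Z * (1 - \<delta>) \<le> Z + (\<mu> - real k * Z) * (v - 1)" by (simp add: algebra_simps)
    then have "v ^ k * (Z * (1 - \<delta>)) \<le> v ^ k * (Z + (\<mu> - real k * Z) * (v - 1))"
      using v by (intro mult_left_mono) auto
    also have "\<dots> \<le> (\<Sum>a\<in>A. c a * v ^ sum (e a) S)" using growth[of v k S] v by (simp add: \<mu>_def)
    finally have gr: "Z * v ^ k * (1 - \<delta>) \<le> (\<Sum>a\<in>A. c a * v ^ sum (e a) S)" by (simp add: ac_simps)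
    show ?thesis
    proof (rule step[of v i0 S])
      show "Z * v ^ sum \<kappa> S * (1 - \<delta>) \<le> (\<Sum>a\<in>A. c a * v ^ sum (e a) S)" using gr by (simp add: k_def)
      show "\<exists>\<eta>>1. {i. \<theta> \<le> (if i \<in> S then y i / v else y i)} = {i. \<eta> \<le> y i} \<and>
        (if 1 < v then {i. \<eta> \<le> y i} \<subseteq> S else {i. \<eta> \<le> y i} \<inter> S = {})" if \<theta>: "1 < \<theta>" for \<theta>
      proof (intro exI[of _ \<theta>] conjI)
        have "\<not> \<theta> \<le> y i / v" if "i \<in> S" for i
        proof -
          have "y i / v \<le> 1" using vS[OF that] v by simp
          then show ?thesis using \<theta> by simp
        qed
        moreover have "\<not> \<theta> \<le> y i" for i using 3(1) \<theta> by (meson le_less_trans not_le)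
        ultimately show "{i. \<theta> \<le> (if i \<in> S then y i / v else y i)} = {i. \<theta> \<le> y i}"
          "if 1 < v then {i. \<theta> \<le> y i} \<subseteq> S else {i. \<theta> \<le> y i} \<inter> S = {}" by auto
      qed (rule \<theta>)
      show "\<exists>\<eta><1. {i. (if i \<in> S then y i / v else y i) \<le> \<theta>} = {i. y i \<le> \<eta>} \<and>
        (if 1 < v then {i. y i \<le> \<eta>} \<inter> S = {} else {i. y i \<le> \<eta>} \<subseteq> S)" if \<theta>: "\<theta> < 1" for \<theta>
      proof (intro exI[of _ "\<theta> * v"] conjI)
        have "\<theta> * v < v" using \<theta> v by simp
        then show \<eta>: "\<theta> * v < 1" using v by linarith
        have "y i / v \<le> \<theta> \<longleftrightarrow> y i \<le> \<theta> * v" for i using v by (simp add: field_simps)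
        moreover have "\<not> y i \<le> \<theta>" "\<not> y i \<le> \<theta> * v" if "i \<notin> S" for i
          using that \<theta> \<eta> by (auto simp: S_def)
        ultimately show "{i. (if i \<in> S then y i / v else y i) \<le> \<theta>} = {i. y i \<le> \<theta> * v}" by auto
        show "if 1 < v then {i. y i \<le> \<theta> * v} \<inter> S = {} else {i. y i \<le> \<theta> * v} \<subseteq> S"
          using v \<eta> by (auto simp: S_def)
      qed
    qed (use i0 v in \<open>auto simp: S_def\<close>)
  qed
qed

subsection \<open>From capacity to coefficients\<close>

lemma stable_wsum_extract:
  fixes \<kappa> :: "'n::finite \<Rightarrow> nat" and i :: 'n
  assumes st: "stable_wsum A e c" and C: "0 < C"
    and cap: "\<And>x. (\<And>i. 0 < x i) \<Longrightarrow> C * (\<Prod>i\<in>UNIV. x i ^ \<kappa> i) \<le> wsum A e c x"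
  defines "A' \<equiv> {a \<in> A. e a i = \<kappa> i}" and "g \<equiv> real (\<kappa> i) ^ \<kappa> i * exp (- real (\<kappa> i)) / fact (\<kappa> i)"
  shows "stable_wsum A' e c"
    and "\<And>x. (\<And>i. 0 < x i) \<Longrightarrow> C * g * (\<Prod>i\<in>UNIV. x i ^ \<kappa> i) \<le> wsum A' e c x"
proof -
  have fin: "finite A" using st by (rule stable_wsum_finite)
  have g: "0 < g" by (cases "\<kappa> i") (auto simp: g_def)
  show bound: "C * g * (\<Prod>i\<in>UNIV. x i ^ \<kappa> i) \<le> wsum A' e c x" if x: "\<And>i. 0 < x i" for x
  proof -
    define p where "p = (\<Prod>l\<in>-{i}. x l ^ \<kappa> l)"
    have p: "0 < p" using x by (auto simp: p_def intro!: prod_pos)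
    define f where "f = upoly A (\<lambda>a. c a * (\<Prod>l\<in>-{i}. x l ^ e a l)) (\<lambda>a. sum (e a) {i})"
    note f = stable_upoly_slice[OF st, where x = x and S = "{i}", OF x, folded f_def]
    obtain M where M: "f = smult (lead_coeff f) (\<Prod>\<rho>\<in>#M. [:\<rho>, 1:])" "\<And>\<rho>. \<rho> \<in># M \<Longrightarrow> 0 \<le> \<rho>"
    proof (rule stable_poly_factorization)
      show "f \<noteq> 0" using f(1) by auto
      show "poly f r \<noteq> 0" if "0 < r" for r using f(2)[OF that] by simp
    qed (use f(3) in auto)
    have "C * p * (real (\<kappa> i) ^ \<kappa> i * exp (- real (\<kappa> i)) / fact (\<kappa> i)) \<le> poly.coeff f (\<kappa> i)"
    proof (rule coeff_ge_capacity[OF M(1) f(1) M(2)])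
      show "0 \<le> C * p" using C p by simp
      show "C * p * w ^ \<kappa> i \<le> poly f w" if w: "0 < w" for w
      proof -
        have "(\<Prod>l\<in>UNIV. (if l \<in> {i} then w else x l) ^ \<kappa> l) = w ^ \<kappa> i * p"
          unfolding prod_power_if by (simp add: p_def)
        then have "C * p * w ^ \<kappa> i \<le> wsum A e c (\<lambda>l. if l \<in> {i} then w else x l)"
          using cap[of "\<lambda>l. if l \<in> {i} then w else x l"] w x by (simp add: ac_simps)
        then show ?thesis unfolding wsum_slice f_def by simp
      qed
    qed
    then have "x i ^ \<kappa> i * (C * p * g) \<le> x i ^ \<kappa> i * poly.coeff f (\<kappa> i)"
      using x[of i] by (intro mult_left_mono) (auto simp: g_def)
    moreover have "x i ^ \<kappa> i * poly.coeff f (\<kappa> i) = wsum A' e c x"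
    proof -
      have "x i ^ \<kappa> i * poly.coeff f (\<kappa> i) = (\<Sum>a\<in>A'. x i ^ \<kappa> i * (c a * (\<Prod>l\<in>-{i}. x l ^ e a l)))"
        unfolding f_def coeff_upoly A'_def by (auto simp: sum.inter_filter fin sum_distrib_left intro!: sum.cong)
      also have "\<dots> = wsum A' e c x"
        unfolding wsum_def
        by (intro sum.cong refl) (subst prod.remove[of UNIV i], auto simp: A'_def Compl_eq_Diff_UNIV)
      finally show ?thesis .
    qed
    moreover have "(\<Prod>i\<in>UNIV. x i ^ \<kappa> i) = x i ^ \<kappa> i * p"
      unfolding p_def Compl_eq_Diff_UNIV by (rule prod.remove) auto
    ultimately show ?thesis by (simp add: ac_simps)
  qed
  \<comment> \<open>The bound at the point of all ones yields a term of positive weight, as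
    \<open>stable_wsum_filter\<close> requires.\<close>
  have "0 < C * g * (\<Prod>i::'n\<in>UNIV. 1 ^ \<kappa> i)" using C g by simp
  also have "\<dots> \<le> wsum A' e c (\<lambda>_. 1)" by (rule bound) simp
  finally have "0 < sum c A'" by (simp add: wsum_def)
  then have "\<exists>a\<in>A'. 0 < c a" by (meson not_le sum_nonpos)
  then show "stable_wsum A' e c" unfolding A'_def by (intro stable_wsum_filter[OF st]) auto
qed

text \<open>In the induction \<open>I\<close> holds the variables whose exponents are already fixed;
  each further one costs its factor \<open>g j\<close> and leaves stability and a capacity bound for
  the next.\<close>

lemma stable_wsum_coeff_ge_capacity:
  fixes \<kappa> :: "'n::finite \<Rightarrow> nat"
  assumes st: "stable_wsum A e c" and C: "0 < C"
    and cap: "\<And>x. (\<And>i. 0 < x i) \<Longrightarrow> C * (\<Prod>i\<in>UNIV. x i ^ \<kappa> i) \<le> wsum A e c x"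
  shows "C * (\<Prod>i\<in>UNIV. real (\<kappa> i) ^ \<kappa> i * exp (- real (\<kappa> i)) / fact (\<kappa> i)) \<le> (\<Sum>a | a \<in> A \<and> e a = \<kappa>. c a)"
proof -
  define g where "g = (\<lambda>i. real (\<kappa> i) ^ \<kappa> i * exp (- real (\<kappa> i)) / fact (\<kappa> i))"
  have g: "0 < g i" for i by (cases "\<kappa> i") (auto simp: g_def)
  have key: "stable_wsum {a \<in> A. \<forall>i\<in>I. e a i = \<kappa> i} e c \<and>
    (\<forall>x. (\<forall>i. 0 < x i) \<longrightarrow> C * prod g I * (\<Prod>i\<in>UNIV. x i ^ \<kappa> i) \<le> wsum {a \<in> A. \<forall>i\<in>I. e a i = \<kappa> i} e c x)"
    if "finite I" for I
    using that
  proof (induction I)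
    case empty
    then show ?case using st cap by simp
  next
    case (insert j I)
    let ?A = "{a \<in> A. \<forall>i\<in>I. e a i = \<kappa> i}"
    have A: "{a \<in> A. \<forall>i\<in>insert j I. e a i = \<kappa> i} = {a \<in> ?A. e a j = \<kappa> j}" by auto
    have pos: "0 < C * prod g I" using C g by (simp add: prod_pos)
    have st': "stable_wsum ?A e c" using insert.IH by blast
    have cap': "C * prod g I * (\<Prod>i\<in>UNIV. x i ^ \<kappa> i) \<le> wsum ?A e c x" if "\<And>i. 0 < x i" for x
      using insert.IH that by blast
    have ins: "C * prod g (insert j I) = C * prod g I * g j" using insert.hyps by (simp add: ac_simps)
    note ex = stable_wsum_extract[OF st' pos cap', where i = j]
    show ?case unfolding A ins using ex by (auto simp only: g_def)
  qed
  have "C * prod g UNIV * (\<Prod>i\<in>UNIV. 1 ^ \<kappa> i) \<le> wsum {a \<in> A. \<forall>i\<in>UNIV. e a i = \<kappa> i} e c (\<lambda>_. 1)"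
    using key[OF finite_class.finite_UNIV, THEN conjunct2, rule_format, of "\<lambda>_. 1"] by simp
  moreover have "{a \<in> A. \<forall>i\<in>UNIV. e a i = \<kappa> i} = {a. a \<in> A \<and> e a = \<kappa>}" by auto
  ultimately show ?thesis by (simp add: wsum_def g_def)
qed

section \<open>Transfer of the coefficient bound to \<open>rpoly\<close>\<close>

lemma mpoly_eval_eq_wsum: "mpoly_eval p = wsum (Poly_Mapping.keys p) Poly_Mapping.lookup (Poly_Mapping.lookup p)"
  by (simp add: fun_eq_iff mpoly_eval_def wsum_def)

text \<open>For weights of sum 1 the right-hand side is the mean exponent of the variable
  \<open>i\<close>.\<close>

lemma mpoly_gradient_one:
  "mpoly_gradient p (\<lambda>_. 1) i = (\<Sum>m\<in>Poly_Mapping.keys p. Poly_Mapping.lookup p m * real (Poly_Mapping.lookup m i))"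
proof -
  have "mpoly_eval p ((\<lambda>_. 1)(i := t)) = (\<Sum>m\<in>Poly_Mapping.keys p. Poly_Mapping.lookup p m * t ^ Poly_Mapping.lookup m i)" for t :: real
    unfolding mpoly_eval_def by (intro sum.cong refl) (subst prod.remove[of UNIV i], auto)
  moreover have "((\<lambda>t::real. \<Sum>m\<in>Poly_Mapping.keys p. Poly_Mapping.lookup p m * t ^ Poly_Mapping.lookup m i) has_field_derivative
      (\<Sum>m\<in>Poly_Mapping.keys p. Poly_Mapping.lookup p m * real (Poly_Mapping.lookup m i))) (at 1)"
    by (auto intro!: derivative_eq_intros sum.cong)
  ultimately show ?thesis by (simp add: mpoly_gradient_def DERIV_imp_deriv)
qed

text \<open>The distance bounds the deviation of the mean exponent on every set of variables, which
  is what the capacity bound asks for on level sets.\<close>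

lemma coeff_lower_bound:
  fixes p :: "'n::finite rpoly"
  assumes p: "nonneg_coeffs p" "real_stable p" "mpoly_eval p (\<lambda>_. 1 :: real) = 1" and \<delta>: "grad_dist \<kappa> p < 1"
  shows "(\<Prod>i\<in>UNIV. real (Poly_Mapping.lookup \<kappa> i) ^ Poly_Mapping.lookup \<kappa> i * exp (- real (Poly_Mapping.lookup \<kappa> i))
            / fact (Poly_Mapping.lookup \<kappa> i)) * (1 - grad_dist \<kappa> p) ^ CARD('n) \<le> Poly_Mapping.lookup p \<kappa>"
proof -
  let ?A = "Poly_Mapping.keys p" and ?e = "Poly_Mapping.lookup :: ('n \<Rightarrow>\<^sub>0 nat) \<Rightarrow> 'n \<Rightarrow> nat" and ?c = "Poly_Mapping.lookup p"
  define d where "d = grad_dist \<kappa> p"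
  have st: "stable_wsum ?A ?e ?c"
    using p(1,2) by (simp add: stable_wsum_def nonneg_coeffs_def real_stable_def mpoly_eval_eq_wsum)
  have Z: "sum ?c ?A = 1" using p(3) by (simp add: mpoly_eval_def)
  have d0: "0 \<le> d" by (simp add: d_def grad_dist_def l1_norm_def sum_nonneg)
  have dist: "\<bar>real (sum (?e \<kappa>) T) - (\<Sum>m\<in>?A. ?c m * real (sum (?e m) T))\<bar> \<le> d" for T
  proof -
    have "(\<Sum>m\<in>?A. ?c m * real (sum (?e m) T)) = (\<Sum>i\<in>T. mpoly_gradient p (\<lambda>_. 1) i)"
      unfolding mpoly_gradient_one of_nat_sum sum_distrib_left by (rule sum.swap)
    then have "\<bar>real (sum (?e \<kappa>) T) - (\<Sum>m\<in>?A. ?c m * real (sum (?e m) T))\<bar>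
        = \<bar>\<Sum>i\<in>T. real (?e \<kappa> i) - mpoly_gradient p (\<lambda>_. 1) i\<bar>"
      by (simp add: sum_subtractf)
    also have "\<dots> \<le> (\<Sum>i\<in>T. \<bar>real (?e \<kappa> i) - mpoly_gradient p (\<lambda>_. 1) i\<bar>)" by (rule sum_abs)
    also have "\<dots> \<le> d" unfolding d_def grad_dist_def l1_norm_def by (intro sum_mono2) auto
    finally show ?thesis .
  qed
  have cap: "(1 - d) ^ CARD('n) * (\<Prod>i\<in>UNIV. y i ^ ?e \<kappa> i) \<le> wsum ?A ?e ?c y" if y: "\<And>i. 0 < y i" for y
  proof -
    have "(1 - d) ^ CARD('n) \<le> (1 - d) ^ card {i. y i \<noteq> 1}"
      using \<delta> d0 by (intro power_decreasing card_mono) (auto simp: d_def)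
    moreover have "0 \<le> (\<Prod>i\<in>UNIV. y i ^ ?e \<kappa> i)" using y by (intro prod_nonneg) (auto simp: less_imp_le)
    ultimately have "(1 - d) ^ CARD('n) * (\<Prod>i\<in>UNIV. y i ^ ?e \<kappa> i) \<le> (1 - d) ^ card {i. y i \<noteq> 1} * (\<Prod>i\<in>UNIV. y i ^ ?e \<kappa> i)"
      by (rule mult_right_mono)
    also have "\<dots> \<le> wsum ?A ?e ?c y"
      using stable_wsum_capacity[OF st, where y = y and \<kappa> = "?e \<kappa>" and \<delta> = d, OF y d0] \<delta> dist by (simp add: Z d_def abs_le_iff algebra_simps)
    finally show ?thesis .
  qed
  have "(1 - d) ^ CARD('n) * (\<Prod>i\<in>UNIV. real (?e \<kappa> i) ^ ?e \<kappa> i * exp (- real (?e \<kappa> i)) / fact (?e \<kappa> i))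
     \<le> (\<Sum>m | m \<in> ?A \<and> ?e m = ?e \<kappa>. ?c m)"
    by (rule stable_wsum_coeff_ge_capacity[OF st _ cap]) (use \<delta> in \<open>simp_all add: d_def\<close>)
  also have "\<dots> = ?c \<kappa>"
  proof -
    have "{m. m \<in> ?A \<and> ?e m = ?e \<kappa>} = (if \<kappa> \<in> ?A then {\<kappa>} else {})" by (auto simp: Poly_Mapping.lookup_inject)
    then show ?thesis by (simp add: in_keys_iff)
  qed
  finally show ?thesis by (simp add: d_def mult.commute)
qed

subsection \<open>The extremal polynomial\<close>

lemma mpoly_eval_superset:
  assumes "finite B" "Poly_Mapping.keys p \<subseteq> B"
  shows "mpoly_eval p x = (\<Sum>m\<in>B. of_real (Poly_Mapping.lookup p m) * (\<Prod>i\<in>UNIV. x i ^ Poly_Mapping.lookup m i))"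
  unfolding mpoly_eval_def using assms by (intro sum.mono_neutral_left) (auto simp: in_keys_iff)

lemma mpoly_eval_add: "mpoly_eval (p + q) x = mpoly_eval p x + mpoly_eval q x"
  by (subst (1 2 3) mpoly_eval_superset[of "Poly_Mapping.keys p \<union> Poly_Mapping.keys q"])
     (use keys_add[of p q] in \<open>auto simp: lookup_add algebra_simps sum.distrib\<close>)

lemma mpoly_eval_single:
  "mpoly_eval (Poly_Mapping.single m r) x = of_real r * (\<Prod>i\<in>UNIV. x i ^ Poly_Mapping.lookup m i)"
  by (simp add: mpoly_eval_def)

lemma mpoly_eval_sum: "mpoly_eval (\<Sum>a\<in>A. p a) x = (\<Sum>a\<in>A. mpoly_eval (p a) x)"
  by (induction A rule: infinite_finite_induct) (simp_all add: mpoly_eval_add, simp_all add: mpoly_eval_def)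

lemma prod_power_lookup_sum:
  fixes x :: "'n::finite \<Rightarrow> 'b::comm_semiring_1"
  shows "(\<Prod>i\<in>UNIV. x i ^ Poly_Mapping.lookup (\<Sum>a\<in>A. h a) i) = (\<Prod>a\<in>A. \<Prod>i\<in>UNIV. x i ^ Poly_Mapping.lookup (h a) i)"
  by (induction A rule: infinite_finite_induct) (simp_all add: lookup_add power_add prod.distrib)

lemma prod_power_lookup_single:
  fixes x :: "'n::finite \<Rightarrow> 'b::comm_semiring_1"
  shows "(\<Prod>i\<in>UNIV. x i ^ Poly_Mapping.lookup (Poly_Mapping.single j k) i) = x j ^ k"
  by (subst prod.remove[of _ j]) (auto simp: lookup_single intro!: prod.neutral)

text \<open>The extremal polynomial is a path: enumerating the variables as \<open>x\<^sub>0, \<dots>, x\<^sub>n\<^sub>-\<^sub>1\<close> and putting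
  \<open>x\<^sub>n = 1\<close>, it is the product of all \<open>x\<^sub>i ^ (\<kappa>\<^sub>i - 1) * ((1 - \<delta>) * x\<^sub>i + \<delta> * x\<^sub>i\<^sub>+\<^sub>1)\<close>. The expected
  exponents telescope, so only \<open>x\<^sub>0\<close> contributes to the distance, whereas \<open>x\<^sup>\<kappa>\<close> arises only by
  choosing the first summand in every factor.\<close>

lemma tight_polynomial:
  fixes \<kappa> :: "'n::finite \<Rightarrow>\<^sub>0 nat"
  assumes \<kappa>: "\<And>i. 0 < Poly_Mapping.lookup \<kappa> i" and \<delta>: "0 \<le> \<delta>" "\<delta> < 1"
  shows "\<exists>p :: 'n rpoly. nonneg_coeffs p \<and> real_stable p \<and> mpoly_eval p (\<lambda>_. 1 :: real) = 1 \<and>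
    grad_dist \<kappa> p = \<delta> \<and> Poly_Mapping.lookup p \<kappa> = (1 - \<delta>) ^ CARD('n)"
proof -
  obtain f :: "'n \<Rightarrow> nat" where f: "bij_betw f UNIV {0..<CARD('n)}"
    using ex_bij_betw_finite_nat[of "UNIV :: 'n set"] by auto
  have finj: "f i = f j \<longleftrightarrow> i = j" for i j using f by (auto simp: bij_betw_def inj_on_def)
  have fsurj: "\<exists>i. f i = k" if "k < CARD('n)" for k
  proof -
    have "k \<in> range f" using that bij_betw_imp_surj_on[OF f] by simp
    then show ?thesis by auto
  qed
  have flt: "f i < CARD('n)" for i using f by (auto simp: bij_betw_def)
  \<comment> \<open>The successor in the enumeration, unspecified for the last variable; there
    \<open>nx\<close> is the exponent vector 0 of the constant 1.\<close>
  define s where "s = (\<lambda>i. SOME j. f j = Suc (f i))"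
  have s: "f (s i) = Suc (f i)" if "Suc (f i) < CARD('n)" for i
    unfolding s_def by (rule someI_ex[OF fsurj[OF that]])
  define k where "k = (\<lambda>i. Poly_Mapping.lookup \<kappa> i - 1)"
  have k: "Poly_Mapping.lookup \<kappa> i = Suc (k i)" for i using \<kappa>[of i] by (simp add: k_def)
  define nx where "nx = (\<lambda>i. if Suc (f i) < CARD('n) then Poly_Mapping.single (s i) (1::nat) else 0)"
  \<comment> \<open>In the expanded product \<open>T\<close> is the set of factors contributing
    their second summand; \<open>m T\<close> and \<open>c T\<close> are the exponent vector and the
    weight of that term.\<close>
  define m where "m = (\<lambda>T. \<Sum>i\<in>UNIV. Poly_Mapping.single i (k i) + (if i \<in> T then nx i else Poly_Mapping.single i 1))"
  define c where "c = (\<lambda>T::'n set. (\<Prod>i\<in>T. \<delta>) * (\<Prod>i\<in>UNIV - T. 1 - \<delta>))"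
  define p where "p = (\<Sum>T\<in>Pow UNIV. Poly_Mapping.single (m T) (c T))"
  have eval: "mpoly_eval p x = (\<Prod>i\<in>UNIV. x i ^ k i * (of_real \<delta> * (if Suc (f i) < CARD('n) then x (s i) else 1) + of_real (1 - \<delta>) * x i))"
    for x :: "'n \<Rightarrow> 'b::{real_algebra_1,comm_ring_1}"
  proof -
    define nv where "nv = (\<lambda>i. if Suc (f i) < CARD('n) then x (s i) else 1)"
    have mon: "(\<Prod>i\<in>UNIV. x i ^ Poly_Mapping.lookup (m T) i) = (\<Prod>i\<in>UNIV. x i ^ k i) * ((\<Prod>i\<in>T. nv i) * (\<Prod>i\<in>UNIV - T. x i))" for T
    proof -
      have "(\<Prod>j\<in>UNIV. x j ^ Poly_Mapping.lookup (Poly_Mapping.single i (k i) + (if i \<in> T then nx i else Poly_Mapping.single i 1)) j)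
          = x i ^ k i * (if i \<in> T then nv i else x i)" for i
        by (auto simp: lookup_add power_add prod.distrib prod_power_lookup_single nx_def nv_def)
      then have "(\<Prod>i\<in>UNIV. x i ^ Poly_Mapping.lookup (m T) i) = (\<Prod>i\<in>UNIV. x i ^ k i) * (\<Prod>i\<in>UNIV. if i \<in> T then nv i else x i)"
        unfolding m_def prod_power_lookup_sum by (simp add: prod.distrib)
      also have "(\<Prod>i\<in>UNIV. if i \<in> T then nv i else x i) = (\<Prod>i\<in>T. nv i) * (\<Prod>i\<in>UNIV - T. x i)"
        by (subst prod.If_cases) (auto simp: Compl_eq_Diff_UNIV)
      finally show ?thesis .
    qed
    have "mpoly_eval p x = (\<Sum>T\<in>Pow UNIV. (\<Prod>i\<in>UNIV. x i ^ k i) * ((\<Prod>i\<in>T. of_real \<delta> * nv i) * (\<Prod>i\<in>UNIV - T. of_real (1 - \<delta>) * x i)))"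
      unfolding p_def mpoly_eval_sum mpoly_eval_single mon
      by (intro sum.cong refl) (simp add: c_def prod.distrib ac_simps)
    also have "\<dots> = (\<Prod>i\<in>UNIV. x i ^ k i) * (\<Prod>i\<in>UNIV. of_real \<delta> * nv i + of_real (1 - \<delta>) * x i)"
      by (subst prod_add) (auto simp: sum_distrib_left)
    finally show ?thesis by (simp add: nv_def prod.distrib)
  qed
  have c0: "0 \<le> c T" for T using \<delta> by (auto simp: c_def)
  have lookup_p: "Poly_Mapping.lookup p a = (\<Sum>T\<in>Pow UNIV. if m T = a then c T else 0)" for a
    by (simp add: p_def lookup_sum lookup_single when_def)
  have "nonneg_coeffs p"
    unfolding nonneg_coeffs_def lookup_p using c0 by (auto intro: sum_nonneg)
  moreover have "real_stable p"
    unfolding real_stable_def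
  proof (intro allI impI)
    fix z :: "'n \<Rightarrow> complex" assume z: "\<forall>i. 0 < Im (z i)"
    have "z i ^ k i * (of_real \<delta> * (if Suc (f i) < CARD('n) then z (s i) else 1) + of_real (1 - \<delta>) * z i) \<noteq> 0" for i
    proof -
      \<comment> \<open>The summand with weight \<open>1 - \<delta> > 0\<close> has positive
        imaginary part and the other one a nonnegative one.\<close>
      have im: "0 < Im (of_real \<delta> * (if Suc (f i) < CARD('n) then z (s i) else 1) + of_real (1 - \<delta>) * z i)"
        using \<delta> z by (auto intro!: add_nonneg_pos simp: less_imp_le)
      have nz: "w \<noteq> 0" if "0 < Im w" for w using that by auto
      show ?thesis using z by (intro no_zero_divisors power_not_zero nz im) auto
    qed
    then show "mpoly_eval p z \<noteq> 0" unfolding eval by (subst prod_zero_iff) auto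
  qed
  moreover have "mpoly_eval p (\<lambda>_. 1 :: real) = 1" by (simp add: eval)
  moreover have "grad_dist \<kappa> p = \<delta>"
  proof -
    have grad: "mpoly_gradient p (\<lambda>_. 1) j = real (Poly_Mapping.lookup \<kappa> j) - (if f j = 0 then \<delta> else 0)" for j
    proof -
      define x where "x = (\<lambda>t::real. (\<lambda>_. 1)(j := t))"
      \<comment> \<open>The variable \<open>j\<close> occurs in its own factor and as second summand
        in the factor of its predecessor.\<close>
      define D where "D = (\<lambda>i. (if i = j then real (k j) + (1 - \<delta>) else 0) + (if Suc (f i) = f j then \<delta> else 0))"
      define F where "F = (\<lambda>i t. x t i ^ k i * (\<delta> * (if Suc (f i) < CARD('n) then x t (s i) else 1) + (1 - \<delta>) * x t i))"
      have F1: "F i 1 = 1" for i by (simp add: F_def x_def)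
      have sj: "s i = j \<longleftrightarrow> Suc (f i) = f j" if "Suc (f i) < CARD('n)" for i
        using s[OF that] finj by metis
      have dF: "(F i has_field_derivative D i) (at 1)" for i
      proof (cases "i = j")
        case True
        then have "F i = (\<lambda>t. t ^ k j * (\<delta> + (1 - \<delta>) * t))"
          using sj[of i] by (auto simp: F_def x_def fun_eq_iff)
        moreover have "((\<lambda>t. t ^ k j * (\<delta> + (1 - \<delta>) * t)) has_field_derivative real (k j) + (1 - \<delta>)) (at 1)"
          by (auto intro!: derivative_eq_intros)
        ultimately show ?thesis using True by (simp add: D_def)
      next
        case False
        show ?thesis
        proof (cases "Suc (f i) = f j")
          case True
          then have "F i = (\<lambda>t. \<delta> * t + (1 - \<delta>))"
            using False sj[of i] flt[of j] by (auto simp: F_def x_def fun_eq_iff)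
          moreover have "((\<lambda>t. \<delta> * t + (1 - \<delta>)) has_field_derivative \<delta>) (at 1)"
            by (auto intro!: derivative_eq_intros)
          ultimately show ?thesis using True False by (simp add: D_def)
        next
          case neq: False
          then have "F i = (\<lambda>t. 1)"
            using False sj[of i] by (auto simp: F_def x_def fun_eq_iff)
          then show ?thesis using neq False by (simp add: D_def)
        qed
      qed
      have "((\<lambda>t. \<Prod>i\<in>UNIV. F i t) has_field_derivative (\<Sum>i\<in>UNIV. D i * (\<Prod>l\<in>UNIV - {i}. F l 1))) (at 1)"
        by (rule has_field_derivative_prod) (rule dF)
      moreover have "(\<lambda>t. mpoly_eval p ((\<lambda>_. 1)(j := t))) = (\<lambda>t. \<Prod>i\<in>UNIV. F i t)"
        by (simp only: eval F_def x_def of_real_eq_id id_apply)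
      ultimately have "mpoly_gradient p (\<lambda>_. 1) j = (\<Sum>i\<in>UNIV. D i)"
        by (simp add: mpoly_gradient_def DERIV_imp_deriv F1)
      also have "\<dots> = real (k j) + (1 - \<delta>) + (\<Sum>i\<in>UNIV. if Suc (f i) = f j then \<delta> else 0)"
        by (simp add: D_def sum.distrib)
      \<comment> \<open>The predecessor's factor makes up for the loss of \<open>\<delta>\<close>;
        only the first variable has no predecessor.\<close>
      also have "(\<Sum>i\<in>UNIV. if Suc (f i) = f j then \<delta> else 0) = (if f j = 0 then 0 else \<delta>)"
      proof (cases "f j")
        case (Suc q)
        then obtain i where i: "f i = q" using fsurj[of q] flt[of j] by auto
        have "(\<Sum>l\<in>UNIV. if Suc (f l) = f j then \<delta> else 0) = (\<Sum>l\<in>UNIV. if l = i then \<delta> else 0)"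
          using Suc i finj by (intro sum.cong) auto
        then show ?thesis using Suc by simp
      qed simp
      finally show ?thesis by (simp add: k)
    qed
    obtain i0 where i0: "f i0 = 0" using fsurj[of 0] by auto
    have "grad_dist \<kappa> p = (\<Sum>j\<in>UNIV. if j = i0 then \<delta> else 0)"
      unfolding grad_dist_def l1_norm_def grad using \<delta> finj[of _ i0] i0 by (intro sum.cong) auto
    then show ?thesis by simp
  qed
  moreover have "Poly_Mapping.lookup p \<kappa> = (1 - \<delta>) ^ CARD('n)"
  proof -
    have m_lookup: "Poly_Mapping.lookup (m T) j = k j + (\<Sum>i\<in>UNIV. if i \<in> T then Poly_Mapping.lookup (nx i) j else (if i = j then 1 else 0))" for T j
    proof -
      have "Poly_Mapping.lookup (m T) j = (\<Sum>i\<in>UNIV. (if i = j then k j else 0) + (if i \<in> T then Poly_Mapping.lookup (nx i) j else (if i = j then 1 else 0)))"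
        unfolding m_def lookup_sum by (intro sum.cong refl) (auto simp: lookup_add lookup_single)
      then show ?thesis by (simp add: sum.distrib)
    qed
    have "m T = \<kappa> \<longleftrightarrow> T = {}" for T
    proof
      assume mT: "m T = \<kappa>"
      show "T = {}"
      proof (rule ccontr)
        assume "T \<noteq> {}"
        \<comment> \<open>At the first index of \<open>T\<close> the variable is not chosen in its
          own factor, nor supplied by a predecessor in \<open>T\<close>, so its exponent falls short
          by one.\<close>
        then obtain i where i: "i \<in> T" "\<And>l. l \<in> T \<Longrightarrow> f i \<le> f l"
          using ex_has_least_nat[of "\<lambda>i. i \<in> T" _ f] by blast
        have "Poly_Mapping.lookup (nx l) i = 0" if "l \<in> T" for l
          using s[of l] i(2)[OF that] by (auto simp: nx_def lookup_single when_def)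
        then have "Poly_Mapping.lookup (m T) i = k i"
          unfolding m_lookup using i(1) by (auto intro!: sum.neutral)
        then show False using mT k[of i] by simp
      qed
    next
      assume "T = {}"
      then show "m T = \<kappa>" by (intro poly_mapping_eqI) (simp add: m_lookup k)
    qed
    then have "Poly_Mapping.lookup p \<kappa> = c {}" unfolding lookup_p by simp
    then show ?thesis by (simp add: c_def)
  qed
  ultimately show ?thesis by blast
qed

text \<open>Tightness is rendered as exact attainment: at every distance \<open>\<delta>\<close> the
  exhibited coefficient differs from the lower bound by a factor depending on
  \<open>\<kappa>\<close> only.\<close>

theorem corollary2p2:
  fixes \<kappa> :: "'n::finite \<Rightarrow>\<^sub>0 nat"
  shows
    "(\<forall>p :: 'n rpoly.
        nonneg_coeffs p \<and> real_stable p \<and> mpoly_eval p (\<lambda>_. 1 :: real) = 1 \<and> grad_dist \<kappa> p < 1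
        \<longrightarrow> Poly_Mapping.lookup p \<kappa> \<ge>
              (\<Prod>i\<in>UNIV. real (Poly_Mapping.lookup \<kappa> i) ^ Poly_Mapping.lookup \<kappa> i * exp (- real (Poly_Mapping.lookup \<kappa> i))
                          / fact (Poly_Mapping.lookup \<kappa> i))
              * (1 - grad_dist \<kappa> p) ^ CARD('n))
     \<and> ((\<forall>i. 0 < Poly_Mapping.lookup \<kappa> i) \<longrightarrow>
        (\<forall>\<delta>::real. 0 \<le> \<delta> \<and> \<delta> < 1 \<longrightarrow>
          (\<exists>p :: 'n rpoly.
             nonneg_coeffs p \<and> real_stable p \<and> mpoly_eval p (\<lambda>_. 1 :: real) = 1 \<and>
             grad_dist \<kappa> p = \<delta> \<and> Poly_Mapping.lookup p \<kappa> = (1 - \<delta>) ^ CARD('n))))"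
proof (intro conjI allI impI)
  fix p :: "'n rpoly"
  assume "nonneg_coeffs p \<and> real_stable p \<and> mpoly_eval p (\<lambda>_. 1 :: real) = 1 \<and> grad_dist \<kappa> p < 1"
  then show "Poly_Mapping.lookup p \<kappa> \<ge>
      (\<Prod>i\<in>UNIV. real (Poly_Mapping.lookup \<kappa> i) ^ Poly_Mapping.lookup \<kappa> i * exp (- real (Poly_Mapping.lookup \<kappa> i))
                  / fact (Poly_Mapping.lookup \<kappa> i))
      * (1 - grad_dist \<kappa> p) ^ CARD('n)"
    by (intro coeff_lower_bound) auto
qed (intro tight_polynomial, auto)

end
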